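(* Let $d=1$ and $1<p<q$. Then there exists a smooth even function $\eta_0$ on $\mathbb{R}$ such that $\eta_\omega(x)\to\eta_0(x)$ as $\omega\downarrow 0$ for all $x\in\mathbb{R}$. Moreover, $\eta_0$ satisfies the equation $$-\eta_0''+p\phi_0^{p-1}\eta_0-q\phi_0^{q-1}\eta_0=-\phi_0\quad\text{in }\mathbb{R},$$ and, as $x\to\infty$, $$\eta_0(x)\sim -x^{-2/(p-1)+2},\qquad \eta_0'(x)=O\bigl(x^{-2/(p-1)+1}\bigr).$$
   Context: For $\omega\ge 0$, $\phi_\omega$ denotes the unique positive, even, decreasing (and decaying to $0$ at infinity) solution on $\mathbb{R}$ of $-\phi''+\omega\phi+|\phi|^{p-1}\phi-|\phi|^{q-1}\phi=0$. For $\omega>0$, $\eta_\omega:=\partial_\omega\phi_\omega$. Notation: $f(x)\sim g(x)$ as $x\to\infty$ means that there is a constant $c_0>0$ with $\lim_{x\to\infty}f(x)/g(x)=c_0$. *)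

theory Defs
  imports "HOL-Analysis.Analysis" "HOL-Library.Landau_Symbols"
begin

definition smooth :: "(real \<Rightarrow> real) \<Rightarrow> bool" where
  "smooth f \<longleftrightarrow> (\<forall>k x. (deriv ^^ k) f differentiable (at x))"

text \<open>The constant is required to be positive, so \<open>asymp_const f (\<lambda>x. - g x)\<close> with \<open>g > 0\<close>
  means that \<open>f\<close> is eventually negative. This is weaker than the library's
  \<^const>\<open>asymp_equiv\<close>, where the limit of the quotient is \<open>1\<close>.\<close>

definition asymp_const :: "(real \<Rightarrow> real) \<Rightarrow> (real \<Rightarrow> real) \<Rightarrow> bool" where
  "asymp_const f g \<longleftrightarrow> (\<exists>c0>0. ((\<lambda>x. f x / g x) \<longlongrightarrow> c0) at_top)"

text \<open>Solutions are classical. The first line is needed because \<^const>\<open>deriv\<close> returns an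
  unspecified value where the derivative does not exist. For an even function, decreasing means
  decreasing in \<open>\<bar>x\<bar>\<close>.\<close>

definition ground_state :: "real \<Rightarrow> real \<Rightarrow> real \<Rightarrow> (real \<Rightarrow> real) \<Rightarrow> bool" where
  "ground_state p q \<omega> \<phi> \<longleftrightarrow>
     (\<forall>x. \<phi> differentiable (at x)) \<and> (\<forall>x. deriv \<phi> differentiable (at x)) \<and>
     (\<forall>x. - deriv (deriv \<phi>) x + \<omega> * \<phi> x
            + \<bar>\<phi> x\<bar> powr (p - 1) * \<phi> x - \<bar>\<phi> x\<bar> powr (q - 1) * \<phi> x = 0) \<and>
     (\<forall>x. \<phi> x > 0) \<and>
     (\<forall>x. \<phi> (- x) = \<phi> x) \<and>
     strict_antimono_on {0..} \<phi> \<and>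
     (\<phi> \<longlongrightarrow> 0) at_top"

text \<open>Pointwise derivative of the family \<open>\<phi>\<close> in the parameter \<open>\<omega>\<close>.\<close>

definition \<eta> :: "(real \<Rightarrow> real \<Rightarrow> real) \<Rightarrow> real \<Rightarrow> real \<Rightarrow> real" where
  "\<eta> \<phi> \<omega> x = deriv (\<lambda>w. \<phi> w x) \<omega>"

end

theory Submission
  imports Defs
begin

text \<open>A ground state satisfies \<open>\<phi>'\<^sup>2 = \<phi>\<^sup>2 (\<omega> - G \<phi>)\<close>, so \<open>\<phi>\<^sub>\<omega> 0\<close> is the inverse of \<open>G\<close> at \<open>\<omega>\<close>.
  Let \<open>u\<^sub>\<omega>\<close> be the even solution of the linearized equation
  \<open>u'' = (\<omega> + p \<phi>\<^sub>\<omega>\<^bsup>p-1\<^esup> - q \<phi>\<^sub>\<omega>\<^bsup>q-1\<^esup>) u + \<phi>\<^sub>\<omega>\<close> with \<open>u 0\<close> the derivative of this inverse at \<open>\<omega>\<close>.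
  Since \<open>\<phi>'\<close> solves the homogeneous equation, reduction of order gives \<open>u = \<phi>' I - c \<phi>\<close> with an
  explicit integral \<open>I\<close>. Gronwall's inequality, applied to differences of solutions of second order
  equations, shows that \<open>\<phi>\<^sub>\<omega>\<close> depends continuously on \<open>\<omega>\<close>, that its difference quotients in \<open>\<omega>\<close>
  converge to \<open>u\<^sub>\<omega>\<close>, and that \<open>u\<^sub>\<omega>\<close> converges to \<open>u\<^sub>0\<close>, which is therefore the limit \<open>\<eta>\<^sub>0\<close>. For
  \<open>\<omega> = 0\<close> the energy identity is a first order equation whose decay \<open>\<phi> \<sim> x\<^bsup>-2/(p-1)\<^esup>\<close> follows from
  l'Hospital's rule, and \<open>I\<close> grows like \<open>x\<^sup>3\<close>.\<close>

section \<open>Gronwall's inequality and calculus tools\<close>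

lemma second_order_gronwall:
  fixes w w1 w2 :: "real \<Rightarrow> real"
  assumes "\<And>x. (w has_real_derivative w1 x) (at x)"
    and "\<And>x. (w1 has_real_derivative w2 x) (at x)"
    and bound: "\<And>x. 0 \<le> x \<Longrightarrow> x \<le> X \<Longrightarrow> \<bar>w2 x\<bar> \<le> K * \<bar>w x\<bar> + e"
    and "w1 0 = 0" and "0 \<le> K" and "0 \<le> x" and "x \<le> X"
  shows "(w x)\<^sup>2 \<le> ((w 0)\<^sup>2 + e\<^sup>2) * exp ((K + 2) * x)"
proof -
  \<comment> \<open>The energy w^2 + w1^2 + e^2 grows at rate at most \<open>K + 2\<close>, by 2ab
    \<le> a^2 + b^2 for each product. Including the constant e^2 absorbs the inhomogeneous term, so
    the weighted energy \<open>E\<close> is nonincreasing.\<close>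
  define E where "E = (\<lambda>x. ((w x)\<^sup>2 + (w1 x)\<^sup>2 + e\<^sup>2) * exp (- ((K + 2) * x)))"
  define E' where "E' = (\<lambda>x. (2 * w x * w1 x + 2 * w1 x * w2 x
      - (K + 2) * ((w x)\<^sup>2 + (w1 x)\<^sup>2 + e\<^sup>2)) * exp (- ((K + 2) * x)))"
  have D: "(E has_real_derivative E' x) (at x)" for x
    unfolding E_def E'_def
    by (rule derivative_eq_intros assms(1,2) refl | simp)+ (simp add: algebra_simps)
  have "E' y \<le> 0" if "0 \<le> y" "y \<le> x" for y
  proof -
    have b: "\<bar>w2 y\<bar> \<le> K * \<bar>w y\<bar> + e"
      using bound that \<open>x \<le> X\<close> by simp
    have "2 * w1 y * w2 y \<le> 2 * (\<bar>w1 y\<bar> * \<bar>w2 y\<bar>)"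
      by (metis abs_ge_self abs_mult mult.assoc mult_left_mono zero_le_numeral)
    also have "\<dots> \<le> 2 * (\<bar>w1 y\<bar> * (K * \<bar>w y\<bar> + e))"
      using b by (simp add: mult_left_mono)
    also have "\<dots> = K * (2 * \<bar>w y\<bar> * \<bar>w1 y\<bar>) + 2 * \<bar>w1 y\<bar> * e"
      by (simp add: algebra_simps)
    also have "\<dots> \<le> K * ((w y)\<^sup>2 + (w1 y)\<^sup>2) + ((w1 y)\<^sup>2 + e\<^sup>2)"
    proof -
      have "2 * \<bar>w y\<bar> * \<bar>w1 y\<bar> \<le> (w y)\<^sup>2 + (w1 y)\<^sup>2"
        using sum_squares_bound[of "\<bar>w y\<bar>" "\<bar>w1 y\<bar>"] by simp
      moreover have "2 * \<bar>w1 y\<bar> * e \<le> (w1 y)\<^sup>2 + e\<^sup>2"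
        using sum_squares_bound[of "\<bar>w1 y\<bar>" e] by simp
      ultimately show ?thesis
        using \<open>0 \<le> K\<close> by (simp add: add_mono mult_left_mono)
    qed
    finally have 1: "2 * w1 y * w2 y \<le> K * ((w y)\<^sup>2 + (w1 y)\<^sup>2) + ((w1 y)\<^sup>2 + e\<^sup>2)" .
    have 2: "2 * w y * w1 y \<le> (w y)\<^sup>2 + (w1 y)\<^sup>2"
      using sum_squares_bound[of "w y" "w1 y"] by simp
    have 3: "0 \<le> K * e\<^sup>2"
      using \<open>0 \<le> K\<close> by simp
    have "2 * w y * w1 y + 2 * w1 y * w2 y - (K + 2) * ((w y)\<^sup>2 + (w1 y)\<^sup>2 + e\<^sup>2) \<le> 0"
    proof -
      have "(K + 2) * ((w y)\<^sup>2 + (w1 y)\<^sup>2 + e\<^sup>2)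
          = K * ((w y)\<^sup>2 + (w1 y)\<^sup>2) + K * e\<^sup>2 + 2 * ((w y)\<^sup>2 + (w1 y)\<^sup>2 + e\<^sup>2)"
        by (simp add: algebra_simps)
      then show ?thesis
        using 1 2 3 zero_le_power2[of "w y"] zero_le_power2[of e] by argo
    qed
    then show ?thesis
      by (simp add: E'_def mult_nonpos_nonneg)
  qed
  then have "E x \<le> E 0"
    using DERIV_nonpos_imp_nonincreasing[OF \<open>0 \<le> x\<close>, of E] D by blast
  then have "((w x)\<^sup>2 + (w1 x)\<^sup>2 + e\<^sup>2) \<le> ((w 0)\<^sup>2 + e\<^sup>2) * exp ((K + 2) * x)"
    using \<open>w1 0 = 0\<close> by (simp add: E_def exp_minus pos_divide_le_eq flip: divide_inverse)
  then show ?thesis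
    using zero_le_power2[of "w1 x"] zero_le_power2[of e] by linarith
qed

lemma DERIV_interval_integral:
  fixes f :: "real \<Rightarrow> real"
  assumes "continuous_on UNIV f"
  shows "((\<lambda>u. LBINT y=0..u. f y) has_real_derivative f x) (at x)"
proof -
  define a b where "a = - \<bar>x\<bar> - 1" and "b = \<bar>x\<bar> + 1"
  have "((\<lambda>u. LBINT y=0..u. f y) has_vector_derivative f x) (at x within {a..b})"
    using interval_integral_FTC2[of a 0 b f x] continuous_on_subset[OF assms]
    by (simp add: a_def b_def zero_ereal_def)
  then have "((\<lambda>u. LBINT y=0..u. f y) has_vector_derivative f x) (at x within {a<..<b})"
    by (rule has_vector_derivative_within_subset) auto
  moreover have "x \<in> {a<..<b}"
    by (auto simp: a_def b_def)
  ultimately show ?thesis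
    by (simp only: has_real_derivative_iff_has_vector_derivative at_within_open[OF _ open_greaterThanLessThan])
qed

text \<open>Subtract a primitive \<open>F\<close> of \<open>g'\<close>: the difference is continuous
  with zero derivative off 0, so on each half-line it equals its value at 0. This carries the
  linearized equation across the origin.\<close>

lemma DERIV_removable:
  fixes g g' :: "real \<Rightarrow> real"
  assumes g: "continuous_on UNIV g" and g': "continuous_on UNIV g'"
    and D: "\<And>x. x \<noteq> 0 \<Longrightarrow> (g has_real_derivative g' x) (at x)"
  shows "(g has_real_derivative g' x) (at x)"
proof -
  define F where "F = (\<lambda>u::real. LBINT y=0..u. g' y)"
  have F: "(F has_real_derivative g' x) (at x)" for x
    unfolding F_def by (rule DERIV_interval_integral[OF g'])
  have cont: "continuous_on {a..b} (\<lambda>x. g x - F x)" for a b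
    by (intro continuous_intros continuous_on_subset[OF g] DERIV_continuous_on[of _ F g'])
      (auto intro: has_field_derivative_at_within F)
  have D0: "((\<lambda>x. g x - F x) has_real_derivative 0) (at x)" if "x \<noteq> 0" for x
    using DERIV_diff[OF D[OF that] F[of x]] by simp
  have "g x - F x = g 0 - F 0" for x
  proof (cases x "0 :: real" rule: linorder_cases)
    case less
    then show ?thesis
      by (intro DERIV_isconst_end[OF less cont D0, symmetric]) auto
  next
    case greater
    then show ?thesis
      by (intro DERIV_isconst_end[OF greater cont D0]) auto
  qed simp
  then have "g = (\<lambda>x. F x + (g 0 - F 0))"
    by (auto simp: fun_eq_iff algebra_simps)
  then show ?thesis
    using DERIV_add[OF F[of x] DERIV_const[of "g 0 - F 0"]] by simp
qed

inductive_set fun_algebra :: "(real \<Rightarrow> real) set \<Rightarrow> (real \<Rightarrow> real) set" for B where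
  base: "f \<in> B \<Longrightarrow> f \<in> fun_algebra B"
| const: "(\<lambda>x. c) \<in> fun_algebra B"
| add: "f \<in> fun_algebra B \<Longrightarrow> g \<in> fun_algebra B \<Longrightarrow> (\<lambda>x. f x + g x) \<in> fun_algebra B"
| mult: "f \<in> fun_algebra B \<Longrightarrow> g \<in> fun_algebra B \<Longrightarrow> (\<lambda>x. f x * g x) \<in> fun_algebra B"

text \<open>By the sum and product rules it suffices to differentiate the generators inside the
  algebra; all iterated derivatives then stay in it.\<close>

lemma fun_algebra_smooth:
  assumes gen: "\<And>f. f \<in> B \<Longrightarrow> \<exists>g\<in>fun_algebra B. \<forall>x. (f has_real_derivative g x) (at x)"
    and "f \<in> fun_algebra B"
  shows "smooth f"
proof -
  have der: "\<exists>g\<in>fun_algebra B. \<forall>x. (f has_real_derivative g x) (at x)"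
    if "f \<in> fun_algebra B" for f
    using that
  proof induction
    case (base f)
    then show ?case by (rule gen)
  next
    case (const c)
    then show ?case by (intro bexI[of _ "\<lambda>x. 0"]) (auto intro: fun_algebra.const)
  next
    case (add f g)
    then obtain f' g' where "f' \<in> fun_algebra B" "g' \<in> fun_algebra B"
      "\<And>x. (f has_real_derivative f' x) (at x)" "\<And>x. (g has_real_derivative g' x) (at x)"
      by blast
    then show ?case
      by (intro bexI[of _ "\<lambda>x. f' x + g' x"]) (auto intro: fun_algebra.add derivative_intros)
  next
    case (mult f g)
    then obtain f' g' where "f' \<in> fun_algebra B" "g' \<in> fun_algebra B"
      "\<And>x. (f has_real_derivative f' x) (at x)" "\<And>x. (g has_real_derivative g' x) (at x)"
      by blast
    then show ?case
      using mult.hyps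
      by (intro bexI[of _ "\<lambda>x. f' x * g x + g' x * f x"])
        (auto intro!: fun_algebra.add fun_algebra.mult DERIV_mult)
  qed
  have "(deriv ^^ k) f \<in> fun_algebra B" for k
  proof (induction k)
    case (Suc k)
    obtain g where g: "g \<in> fun_algebra B" "\<And>x. ((deriv ^^ k) f has_real_derivative g x) (at x)"
      using der[OF Suc.IH] by blast
    then have "deriv ((deriv ^^ k) f) = g"
      by (auto intro: DERIV_imp_deriv)
    then show ?case using g by simp
  qed (use assms in simp)
  then show ?thesis
    unfolding smooth_def using der real_differentiable_def by blast
qed

section \<open>The nonlinearity and the function \<open>G\<close>\<close>

locale exponents =
  fixes p q :: real
  assumes p1: "1 < p" and pq: "p < q"
begin

text \<open>On positive values this is |s|^(p-1) s - |s|^(q-1) s, so a ground state solves f'' =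
  \<omega> f + N(f).\<close>

definition N :: "real \<Rightarrow> real" where
  "N s = s powr p - s powr q"

definition dN :: "real \<Rightarrow> real" where
  "dN s = p * s powr (p - 1) - q * s powr (q - 1)"

text \<open>The energy identity of a ground state reads \<open>\<phi>'\<^sup>2 = \<phi>\<^sup>2 (\<omega> - G \<phi>)\<close>.\<close>

definition G :: "real \<Rightarrow> real" where
  "G s = 2 / (q + 1) * s powr (q - 1) - 2 / (p + 1) * s powr (p - 1)"

definition dG :: "real \<Rightarrow> real" where
  "dG s = 2 / (q + 1) * ((q - 1) * s powr (q - 2)) - 2 / (p + 1) * ((p - 1) * s powr (p - 2))"

lemma DERIV_N: "0 < s \<Longrightarrow> (N has_real_derivative dN s) (at s)"
  unfolding N_def[abs_def] dN_def by (auto intro!: derivative_eq_intros)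

lemma DERIV_G: "0 < s \<Longrightarrow> (G has_real_derivative dG s) (at s)"
  unfolding G_def[abs_def] dG_def
  using has_real_derivative_powr[of s "q - 1"] has_real_derivative_powr[of s "p - 1"]
  by (intro DERIV_diff DERIV_cmult) simp_all

lemma G_eq: "G s = s powr (p - 1) * (2 / (q + 1) * s powr (q - p) - 2 / (p + 1))"
  by (simp add: G_def right_diff_distrib powr_add[symmetric] algebra_simps)

lemma dG_eq: "dG s = s powr (p - 2) * ((q - 1) * (2 / (q + 1) * s powr (q - p)) - (p - 1) * (2 / (p + 1)))"
proof -
  have "s powr (q - 2) = s powr (p - 2) * s powr (q - p)"
    by (simp add: powr_add[symmetric])
  then show ?thesis
    unfolding dG_def by (simp only: right_diff_distrib mult_ac)
qed

text \<open>\<open>G\<close> is negative near 0, so a sign condition enters. If \<open>G s\<close>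
  is nonnegative, both factors in \<open>G_eq\<close> are nonnegative and increase strictly from
  \<open>s\<close> to \<open>t\<close>; if it is negative, \<open>G t\<close> is nonnegative and
  nothing remains.\<close>

lemma G_less:
  assumes "0 < s" "s < t" "0 \<le> G s \<or> 0 \<le> G t"
  shows "G s < G t"
proof (cases "0 \<le> G s")
  case True
  let ?f = "\<lambda>s. 2 / (q + 1) * s powr (q - p) - 2 / (p + 1)"
  have "s powr (p - 1) > 0" "s powr (p - 1) < t powr (p - 1)" "s powr (q - p) < t powr (q - p)"
    using assms p1 pq by (auto intro!: powr_less_mono2)
  moreover have "?f s \<ge> 0"
    using True \<open>0 < s powr (p - 1)\<close> unfolding G_eq by (simp add: zero_le_mult_iff)
  moreover have "?f s < ?f t"
    using \<open>s powr (q - p) < t powr (q - p)\<close> p1 pq by (simp add: divide_strict_right_mono)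
  ultimately show ?thesis
    unfolding G_eq by (intro mult_strict_mono) auto
qed (use assms in linarith)

text \<open>The sign of \<open>G s\<close> says that the \<open>q\<close> term in the bracket of
  \<open>G_eq\<close> dominates the \<open>p\<close> term. In \<open>dG_eq\<close> it still does,
  with the larger weight \<open>q - 1\<close> against \<open>p - 1\<close>.\<close>

lemma dG_pos:
  assumes "0 < s" "0 \<le> G s"
  shows "0 < dG s"
proof -
  have "0 \<le> 2 / (q + 1) * s powr (q - p) - 2 / (p + 1)"
    using assms unfolding G_eq by (simp add: zero_le_mult_iff)
  then have "(q - 1) * (2 / (p + 1)) \<le> (q - 1) * (2 / (q + 1) * s powr (q - p))"
    using p1 pq by (intro mult_left_mono) auto
  moreover have "(p - 1) * (2 / (p + 1)) < (q - 1) * (2 / (p + 1))"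
    using p1 pq by (intro mult_strict_right_mono) auto
  ultimately have "0 < (q - 1) * (2 / (q + 1) * s powr (q - p)) - (p - 1) * (2 / (p + 1))"
    by linarith
  then show ?thesis
    using assms unfolding dG_eq by simp
qed

lemma continuous_on_dG: "continuous_on {0<..} dG"
  unfolding dG_def[abs_def] using p1 pq by (intro continuous_intros) auto

lemma continuous_on_dN: "continuous_on {0..} dN"
  unfolding dN_def[abs_def] using p1 pq
  by (auto intro!: continuous_intros continuous_on_powr')

end

subsection \<open>The ground state at a fixed frequency\<close>

text \<open>The left side is the derivative of s^2 G(s), so -s^2 G(s) is a primitive of 2 N. This
  yields conservation of energy and the value of the second derivative at the maximum.\<close>

lemma (in exponents) G_identity:
  assumes "0 < s"
  shows "2 * s * G s + s\<^sup>2 * dG s = - 2 * N s"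
proof -
  have 1: "s * s powr (r - 1) = s powr r" "s\<^sup>2 * s powr (r - 2) = s powr r" for r
    using assms by (simp_all add: powr_diff power2_eq_square powr_numeral)
  have "2 * s * G s + s\<^sup>2 * dG s
      = 2 / (q + 1) * (2 * (s * s powr (q - 1)) + (q - 1) * (s\<^sup>2 * s powr (q - 2)))
        - 2 / (p + 1) * (2 * (s * s powr (p - 1)) + (p - 1) * (s\<^sup>2 * s powr (p - 2)))"
    unfolding G_def dG_def by (simp add: algebra_simps add_divide_distrib diff_divide_distrib)
  also have "\<dots> = 2 / (q + 1) * ((q + 1) * s powr q) - 2 / (p + 1) * ((p + 1) * s powr p)"
    unfolding 1 by (simp add: algebra_simps)
  also have "\<dots> = - 2 * N s"
    using p1 pq by (simp add: N_def)
  finally show ?thesis .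
qed

lemma DERIV_imp_continuous_on:
  fixes f :: "real \<Rightarrow> real"
  assumes "\<And>x. (f has_real_derivative f' x) (at x)"
  shows "continuous_on A f"
  using assms by (intro continuous_at_imp_continuous_on ballI DERIV_isCont)

locale profile = exponents +
  fixes \<omega> :: real and f :: "real \<Rightarrow> real"
  assumes \<omega>: "0 \<le> \<omega>" and gs: "ground_state p q \<omega> f"
begin

abbreviation f1 :: "real \<Rightarrow> real" where
  "f1 \<equiv> deriv f"

definition f2 :: "real \<Rightarrow> real" where
  "f2 x = \<omega> * f x + N (f x)"

text \<open>The potential of the linearized operator: the derivative of s \<mapsto> \<omega> s +
  N(s) at s = f(x).\<close>

definition V :: "real \<Rightarrow> real" where
  "V x = \<omega> + dN (f x)"

lemma pos: "0 < f x"
  and even: "f (- x) = f x"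
  and anti: "strict_antimono_on {0..} f"
  and lim0: "(f \<longlongrightarrow> 0) at_top"
  using gs unfolding ground_state_def by blast+

lemma D_f: "(f has_real_derivative f1 x) (at x)"
  using gs unfolding ground_state_def by (simp add: DERIV_deriv_iff_real_differentiable)

lemma D_f1: "(f1 has_real_derivative f2 x) (at x)"
proof -
  have "f x powr (r - 1) * f x = f x powr r" for r
    using pos[of x] by (simp add: powr_diff)
  moreover have "- deriv f1 x + \<omega> * f x + \<bar>f x\<bar> powr (p - 1) * f x - \<bar>f x\<bar> powr (q - 1) * f x = 0"
    using gs unfolding ground_state_def by blast
  ultimately have "deriv f1 x = f2 x"
    using pos[of x] by (simp add: f2_def N_def)
  moreover have "f1 differentiable (at x)"
    using gs unfolding ground_state_def by blast
  ultimately show ?thesis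
    by (metis DERIV_deriv_iff_real_differentiable)
qed

lemma D_f2: "(f2 has_real_derivative V x * f1 x) (at x)"
  unfolding f2_def[abs_def] V_def
  by (rule derivative_eq_intros DERIV_chain2[OF DERIV_N[OF pos] D_f] D_f refl)+ (simp add: algebra_simps)

lemma f1_odd: "f1 (- x) = - f1 x"
proof -
  have "((\<lambda>x. f (- x)) has_real_derivative - f1 (- x)) (at x)"
    using D_f[of "- x"] by (simp add: DERIV_mirror)
  then show ?thesis
    using DERIV_unique[OF D_f[of x]] by (simp add: even)
qed

lemma f1_0: "f1 0 = 0"
  using f1_odd[of 0] by simp

text \<open>By \<open>G_identity\<close> the difference \<open>E\<close> of the two sides is
  constant; its value is found at infinity.\<close>

lemma energy: "(f1 x)\<^sup>2 = (f x)\<^sup>2 * (\<omega> - G (f x))"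
proof -
  define H where "H = (\<lambda>x. (f x)\<^sup>2 * (\<omega> - G (f x)))"
  define E where "E = (\<lambda>x. (f1 x)\<^sup>2 - H x)"
  have "(E has_real_derivative 0) (at x)" for x
  proof -
    have "(E has_real_derivative f1 x * (2 * N (f x) + (2 * f x * G (f x) + (f x)\<^sup>2 * dG (f x)))) (at x)"
      unfolding E_def H_def
      by (rule derivative_eq_intros DERIV_chain2[OF DERIV_G[OF pos] D_f] D_f D_f1 refl)+
        (simp add: f2_def algebra_simps power2_eq_square)
    then show ?thesis
      using G_identity[OF pos[of x]] by simp
  qed
  then have const: "E y = E z" for y z
    by (rule DERIV_isconst_all[rule_format]) 
  have "(H \<longlongrightarrow> 0\<^sup>2 * (\<omega> - (2 / (q + 1) * 0 - 2 / (p + 1) * 0))) at_top"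
    unfolding H_def G_def using p1 pq
    by (intro tendsto_intros tendsto_zero_powrI[OF lim0 tendsto_const] lim0) (auto intro: always_eventually less_imp_le pos)
  then have H: "(H \<longlongrightarrow> 0) at_top"
    by simp
  \<comment> \<open>Decay of \<open>f1\<close> is not given. The mean value theorem supplies points
    \<open>z y\<close> beyond \<open>y\<close> at which \<open>f1\<close> is an increment of
    \<open>f\<close>, which tends to 0; evaluating \<open>E\<close> along them is enough.\<close>
  have "\<exists>z>y. f (y + 1) - f y = f1 z" for y
    using MVT2[of y "y + 1" f f1] D_f by auto
  then obtain z where z: "\<And>y. y < z y" "\<And>y. f (y + 1) - f y = f1 (z y)"
    by metis
  have "filterlim z at_top at_top"
    by (rule filterlim_at_top_mono[OF filterlim_ident])
      (use z(1) in \<open>auto intro!: always_eventually less_imp_le\<close>)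
  moreover have "filterlim (\<lambda>y::real. y + 1) at_top at_top"
    by (rule filterlim_at_top_mono[OF filterlim_ident]) simp
  ultimately have "((\<lambda>y. (f (y + 1) - f y)\<^sup>2 - H (z y)) \<longlongrightarrow> (0 - 0)\<^sup>2 - 0) at_top"
    by (intro tendsto_intros filterlim_compose[OF lim0] filterlim_compose[OF H] lim0)
  moreover have "(\<lambda>y. (f (y + 1) - f y)\<^sup>2 - H (z y)) = (\<lambda>y. E x)"
    using const by (auto simp: z(2) E_def)
  ultimately have "E x = 0"
    by (simp add: tendsto_const_iff)
  then show ?thesis
    by (simp add: E_def H_def)
qed

lemma G_top: "G (f 0) = \<omega>"
  using energy[of 0] f1_0 pos[of 0] by simp

lemma dG_top: "0 < dG (f 0)"
  using dG_pos[OF pos] G_top \<omega> by simp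

lemma f_less_top:
  assumes "x \<noteq> 0"
  shows "f x < f 0"
proof -
  have "f y < f 0" if "0 < y" for y
    using anti that by (auto simp: monotone_on_def)
  from this[of x] this[of "- x"] assms show ?thesis
    by (cases "0 < x") (auto simp: even)
qed

lemma f_le_top: "f x \<le> f 0"
  using f_less_top[of x] by (cases "x = 0") auto

text \<open>Monotonicity alone only excludes positive values. That \<open>f1 x\<close> is nonzero
  comes from the energy identity, because \<open>G\<close> lies strictly below \<omega> off the
  maximum.\<close>

lemma f1_neg:
  assumes "0 < x"
  shows "f1 x < 0"
proof -
  have "G (f x) < \<omega>"
    using G_less[OF pos f_less_top[of x]] assms G_top \<omega> by simp
  then have "f1 x \<noteq> 0"
    using energy[of x] pos[of x] by auto
  moreover have "\<not> 0 < f1 x"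
  proof
    assume "0 < f1 x"
    then obtain d where "0 < d" "\<And>h. 0 < h \<Longrightarrow> h < d \<Longrightarrow> f x < f (x + h)"
      using DERIV_pos_inc_right[OF D_f] by blast
    from this(1) this(2)[of "d / 2"] have "f x < f (x + d / 2)" "x < x + d / 2"
      by simp_all
    moreover have "f (x + d / 2) < f x"
      using anti assms \<open>0 < d\<close> by (auto simp: monotone_on_def)
    ultimately show False by simp
  qed
  ultimately show ?thesis by simp
qed

lemma f1_nonzero: "x \<noteq> 0 \<Longrightarrow> f1 x \<noteq> 0"
  using f1_neg[of x] f1_neg[of "- x"] by (cases "0 < x") (auto simp: f1_odd)

section \<open>The linearized equation by reduction of order\<close>

definition c :: real where
  "c = - 1 / (f 0 * dG (f 0))"

text \<open>\<open>num\<close> and \<open>den\<close> express the quotient in \<open>R\<close>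
  through the value s = f(x). In this variable the zero of the denominator at the maximum is simple,
  whereas \<open>f1\<close> squared has a double zero in x.\<close>

definition num :: "real \<Rightarrow> real" where
  "num s = s\<^sup>2 / 2 - c * s * (\<omega> * s + N s)"

definition den :: "real \<Rightarrow> real" where
  "den s = s\<^sup>2 * (\<omega> - G s)"

lemma num_f: "num (f x) = (f x)\<^sup>2 / 2 - c * f x * f2 x"
  by (simp add: num_def f2_def)

lemma den_f: "den (f x) = (f1 x)\<^sup>2"
  by (simp add: den_def energy)

text \<open>This condition determines \<open>c\<close>: \<open>G_identity\<close> at the maximum
  gives \<omega> s + N(s) = -s^2 dG(s) / 2 for s = f(0). The same \<open>c\<close> makes
  \<open>u 0\<close> the derivative of the inverse of \<open>G\<close> at \<omega>.\<close>

lemma num_top: "num (f 0) = 0"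
proof -
  have "2 * N (f 0) = - (2 * f 0 * \<omega> + (f 0)\<^sup>2 * dG (f 0))"
    using G_identity[OF pos[of 0]] G_top by simp
  then have "\<omega> * f 0 + N (f 0) = - ((f 0)\<^sup>2 * dG (f 0)) / 2"
    by argo
  then show ?thesis
    unfolding num_def c_def using pos[of 0] dG_top by (simp add: power2_eq_square)
qed

text \<open>Both \<open>num\<close> and \<open>den\<close> vanish at \<open>f 0\<close>, so their
  quotient is a quotient of difference quotients, and the derivative of \<open>den\<close> there is
  nonzero by \<open>dG_top\<close>.\<close>

lemma num_quotient_limit: "\<exists>l. ((\<lambda>x. num (f x) / (f1 x)\<^sup>2) \<longlongrightarrow> l) (at 0)"
proof -
  let ?M = "f 0"
  define n where "n = ?M - (c * (\<omega> * ?M + N ?M) + c * ?M * (\<omega> + dN ?M))"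
  have n: "(num has_real_derivative n) (at ?M)"
    unfolding num_def n_def
    by (rule derivative_eq_intros numeral_neq_zero DERIV_N pos refl)+ (simp add: algebra_simps)
  have d: "(den has_real_derivative - (?M\<^sup>2 * dG ?M)) (at ?M)"
    unfolding den_def
    by (rule derivative_eq_intros DERIV_G pos refl)+ (simp add: G_top)
  have "?M\<^sup>2 * dG ?M \<noteq> 0"
    using pos[of 0] dG_top by auto
  then have "((\<lambda>s. ((num s - num ?M) / (s - ?M)) / ((den s - den ?M) / (s - ?M))) \<longlongrightarrow> n / - (?M\<^sup>2 * dG ?M)) (at ?M)"
    using n d unfolding has_field_derivative_iff by (intro tendsto_divide) auto
  then have "((\<lambda>s. num s / den s) \<longlongrightarrow> n / - (?M\<^sup>2 * dG ?M)) (at ?M)"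
    by (rule tendsto_cong[THEN iffD1, rotated])
      (auto simp: eventually_at_filter num_top den_f f1_0)
  \<comment> \<open>The punctured limit composes because \<open>f\<close> attains its maximum only
    at 0.\<close>
  moreover have "filterlim f (at ?M) (at 0)"
    using DERIV_isCont[OF D_f[of 0]] f_less_top
    by (auto simp: filterlim_at isCont_def eventually_at_filter less_le)
  ultimately have "((\<lambda>x. num (f x) / den (f x)) \<longlongrightarrow> n / - (?M\<^sup>2 * dG ?M)) (at 0)"
    by (rule filterlim_compose)
  then show ?thesis
    unfolding den_f by blast
qed

text \<open>Differentiating the energy identity in \<open>\<omega>\<close> gives \<open>(\<eta> / \<phi>')' = \<phi>\<^sup>2 / (2 \<phi>'\<^sup>2)\<close>, which is
  singular at \<open>0\<close>. The constant \<open>c\<close> is chosen such that \<open>((\<eta> + c \<phi>) / \<phi>')'\<close>, which is \<open>R\<close>,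
  has a removable singularity there.\<close>

definition R :: "real \<Rightarrow> real" where
  "R x = c + (if x = 0 then Lim (at 0) (\<lambda>x. num (f x) / (f1 x)\<^sup>2) else num (f x) / (f1 x)\<^sup>2)"

definition I :: "real \<Rightarrow> real" where
  "I x = (LBINT y=0..x. R y)"

definition u :: "real \<Rightarrow> real" where
  "u x = f1 x * I x - c * f x"

definition u1 :: "real \<Rightarrow> real" where
  "u1 x = f2 x * I x + f1 x * R x - c * f1 x"

definition u2 :: "real \<Rightarrow> real" where
  "u2 x = V x * u x + f x"

lemma continuous_f: "continuous_on A f"
  by (rule DERIV_imp_continuous_on[OF D_f])

lemma continuous_f1: "continuous_on A f1"
  by (rule DERIV_imp_continuous_on[OF D_f1])

lemma continuous_f2: "continuous_on A f2"
  by (rule DERIV_imp_continuous_on[OF D_f2])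

lemma continuous_dN_f: "continuous_on A (\<lambda>x. dN (f x))"
  by (rule continuous_on_compose2[OF continuous_on_dN continuous_f]) (auto intro: less_imp_le pos)

lemma continuous_V: "continuous_on A V"
  unfolding V_def[abs_def] by (intro continuous_intros continuous_dN_f)

lemma continuous_R: "continuous_on UNIV R"
proof -
  have "isCont R x" for x
  proof (cases "x = 0")
    case True
    have "((\<lambda>x. num (f x) / (f1 x)\<^sup>2) \<longlongrightarrow> Lim (at 0) (\<lambda>x. num (f x) / (f1 x)\<^sup>2)) (at 0)"
      using num_quotient_limit tendsto_Lim[of "at (0::real)"] by auto
    then have "((\<lambda>x. c + num (f x) / (f1 x)\<^sup>2) \<longlongrightarrow> R 0) (at 0)"
      by (auto simp: R_def intro!: tendsto_intros)
    then have "(R \<longlongrightarrow> R 0) (at 0)"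
      by (rule tendsto_cong[THEN iffD1, rotated]) (auto simp: eventually_at_filter R_def)
    then show ?thesis
      using True by (simp add: isCont_def)
  next
    case False
    have ev: "\<forall>\<^sub>F y in nhds x. R y = c + ((f y)\<^sup>2 / 2 - c * f y * f2 y) / (f1 y)\<^sup>2"
      using t1_space_nhds[OF False] by eventually_elim (simp add: R_def num_f)
    have "isCont (\<lambda>y. c + ((f y)\<^sup>2 / 2 - c * f y * f2 y) / (f1 y)\<^sup>2) x"
      using f1_nonzero[OF False]
      by (intro continuous_intros DERIV_isCont[OF D_f] DERIV_isCont[OF D_f1] DERIV_isCont[OF D_f2]) auto
    then show ?thesis
      using isCont_cong[OF ev] by blast
  qed
  then show ?thesis
    by (simp add: continuous_on_eq_continuous_at)
qed

lemma D_I: "(I has_real_derivative R x) (at x)"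
  unfolding I_def[abs_def] by (rule DERIV_interval_integral[OF continuous_R])

lemma I_0: "I 0 = 0"
  by (simp add: I_def zero_ereal_def)

lemma continuous_I: "continuous_on A I"
  by (rule DERIV_imp_continuous_on[OF D_I])

lemma I_odd: "I (- x) = - I x"
proof -
  have "R (- y) = R y" for y
    by (simp add: R_def num_f f2_def even f1_odd)
  then have "((\<lambda>x. I (- x)) has_real_derivative - R y) (at y)" for y
    using D_I[of "- y"] by (simp add: DERIV_mirror)
  from DERIV_add[OF D_I this] have "((\<lambda>x. I x + I (- x)) has_real_derivative 0) (at y)" for y
    by simp
  then have "I x + I (- x) = I 0 + I (- 0)"
    by (rule DERIV_isconst_all[rule_format])
  then show ?thesis
    by (simp add: I_0)
qed

lemma u_even: "u (- x) = u x"
  by (simp add: u_def f1_odd even I_odd)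

lemma D_u: "(u has_real_derivative u1 x) (at x)"
  unfolding u_def[abs_def] u1_def
  by (rule derivative_eq_intros D_f1 D_I D_f refl)+ simp

lemma u1_0: "u1 0 = 0"
  by (simp add: u1_def f1_0 I_0)

lemma u_0: "u 0 = 1 / dG (f 0)"
  using pos[of 0] by (simp add: u_def I_0 c_def)

text \<open>The terms \<open>c * f1 x\<close> cancel. What remains can be differentiated off 0
  without differentiating \<open>R\<close>.\<close>

lemma u1_eq:
  assumes "x \<noteq> 0"
  shows "u1 x = f2 x * I x + ((f x)\<^sup>2 / 2 - c * f x * f2 x) / f1 x"
  using f1_nonzero[OF assms] assms
  by (simp add: u1_def R_def num_f field_simps power2_eq_square)

lemma continuous_u: "continuous_on A u"
  by (rule DERIV_imp_continuous_on[OF D_u])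

text \<open>The form \<open>u1_eq\<close> is available only off 0, but \<open>u1\<close> and
  \<open>u2\<close> are continuous everywhere, so the singularity is removable.\<close>

lemma D_u1: "(u1 has_real_derivative u2 x) (at x)"
proof (rule DERIV_removable)
  show "continuous_on UNIV u1"
    unfolding u1_def[abs_def]
    by (intro continuous_intros continuous_f1 continuous_f2 continuous_I continuous_R)
  show "continuous_on UNIV u2"
    unfolding u2_def[abs_def]
    by (intro continuous_intros continuous_f continuous_V continuous_u)
  show "(u1 has_real_derivative u2 x) (at x)" if "x \<noteq> 0" for x
  proof -
    have ev: "\<forall>\<^sub>F y in nhds x. u1 y = f2 y * I y + ((f y)\<^sup>2 / 2 - c * f y * f2 y) / f1 y"
      using t1_space_nhds[OF that] by eventually_elim (simp add: u1_eq)
    have R: "R x = c + ((f x)\<^sup>2 / 2 - c * f x * f2 x) / (f1 x)\<^sup>2"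
      using that by (simp add: R_def num_f)
    \<comment> \<open>Differentiating \<open>I\<close> produces \<open>f2 x * R x\<close>, which
      cancels the terms with \<open>f2 x\<close> that come from the quotient; the rest is
      \<open>V x * u x + f x\<close>.\<close>
    have "((\<lambda>y. f2 y * I y + ((f y)\<^sup>2 / 2 - c * f y * f2 y) / f1 y) has_real_derivative u2 x) (at x)"
      by (rule derivative_eq_intros D_f D_f1 D_f2 D_I f1_nonzero[OF that]
          numeral_neq_zero refl)+
        (use f1_nonzero[OF that] in \<open>simp add: R u2_def u_def field_simps power2_eq_square\<close>)
    then show ?thesis
      using DERIV_cong_ev[OF refl ev refl] by blast
  qed
qed

end

subsection \<open>Smoothness and decay\<close>

context profile
begin

text \<open>All real powers of the positive function \<open>f\<close> are taken as generators, since
  each differentiation lowers an exponent by one. The two differential equations express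
  \<open>f2\<close> and \<open>u2\<close> through the generators.\<close>

lemma smooth_u: "smooth u"
proof (rule fun_algebra_smooth)
  let ?B = "range (\<lambda>a x. f x powr a) \<union> {f1, u, u1}"
  let ?A = "fun_algebra ?B"
  have gens: "(\<lambda>x. f x powr a) \<in> ?A" "f1 \<in> ?A" "u \<in> ?A" "u1 \<in> ?A" for a
    by (auto intro: fun_algebra.base)
  have f: "f \<in> ?A"
    using gens(1)[of 1] pos by (simp add: less_imp_le)
  have cmult: "(\<lambda>x. r * g x) \<in> ?A" if "g \<in> ?A" for r g
    using fun_algebra.mult[OF fun_algebra.const that] .
  have diff: "(\<lambda>x. g x - h x) \<in> ?A" if "g \<in> ?A" "h \<in> ?A" for g h
    using fun_algebra.add[OF that(1) cmult[OF that(2), of "- 1"]] by simp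
  show "u \<in> ?A"
    by (fact gens)
  have "\<exists>g\<in>?A. \<forall>x. ((\<lambda>x. f x powr a) has_real_derivative g x) (at x)" for a
  proof (intro bexI allI)
    show "((\<lambda>x. f x powr a) has_real_derivative a * f x powr (a - 1) * f1 x) (at x)" for x
      using DERIV_chain2[OF has_real_derivative_powr[OF pos] D_f] by simp
    show "(\<lambda>x. a * f x powr (a - 1) * f1 x) \<in> ?A"
      by (intro fun_algebra.mult fun_algebra.const gens)
  qed
  moreover have "f2 \<in> ?A"
    unfolding f2_def[abs_def] N_def by (intro fun_algebra.add cmult diff gens f)
  moreover have "u2 \<in> ?A"
    unfolding u2_def[abs_def] V_def dN_def
    by (intro fun_algebra.add fun_algebra.mult fun_algebra.const diff gens f)
  ultimately show "\<exists>g'\<in>?A. \<forall>x. (g has_real_derivative g' x) (at x)" if "g \<in> ?B" for g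
    using that D_f1 D_u D_u1 gens by auto
qed

end

section \<open>Decay at zero frequency\<close>

locale zero_profile = profile p q 0 f for p q f
begin

text \<open>The decay exponent: \<open>f\<close> behaves like x^(-a).\<close>

definition a :: real where
  "a = 2 / (p - 1)"

text \<open>This is f^(1/a), the power of \<open>f\<close> that decays like 1/x.\<close>

definition F :: "real \<Rightarrow> real" where
  "F x = f x powr ((p - 1) / 2)"

definition e :: "real \<Rightarrow> real" where
  "e x = f x powr (q - p)"

text \<open>The factor left in the energy identity after dividing by f^2 F^2; it has a positive
  limit.\<close>

definition s :: "real \<Rightarrow> real" where
  "s x = 2 / (p + 1) - 2 / (q + 1) * e x"

definition k :: real where
  "k = (p - 1) / 2 * sqrt (2 / (p + 1))"

lemma k_pos: "0 < k"
  using p1 by (simp add: k_def)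

lemma F_pos: "0 < F x"
  using pos[of x] by (simp add: F_def)

lemma F_square: "(F x)\<^sup>2 = f x powr (p - 1)"
  using pos[of x] by (simp add: F_def power2_eq_square flip: powr_add)

lemma f1_square: "(f1 x)\<^sup>2 = (f x)\<^sup>2 * (F x)\<^sup>2 * s x"
  unfolding energy G_eq F_square s_def e_def by (simp add: algebra_simps)

lemma s_pos:
  assumes "0 < x"
  shows "0 < s x"
proof -
  have "0 < (f x)\<^sup>2 * (F x)\<^sup>2 * s x"
    using f1_neg[OF assms] by (simp flip: f1_square)
  then show ?thesis
    by (rule zero_less_mult_pos) (intro mult_pos_pos zero_less_power pos F_pos)
qed

lemma f1_eq:
  assumes "0 < x"
  shows "f1 x = - (f x * F x * sqrt (s x))"
proof -
  have "- f1 x = sqrt ((f1 x)\<^sup>2)"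
    using f1_neg[OF assms] by simp
  also have "\<dots> = f x * F x * sqrt (s x)"
    unfolding f1_square using pos[of x] F_pos[of x] by (simp add: real_sqrt_mult)
  finally show ?thesis by simp
qed

lemma f2_eq: "f2 x = f x * (F x)\<^sup>2 * (1 - e x)"
proof -
  have "f x * f x powr (p - 1) = f x powr p"
    using pos[of x] by (simp add: powr_diff)
  moreover have "f x powr p * f x powr (q - p) = f x powr q"
    using pos[of x] by (simp flip: powr_add)
  ultimately show ?thesis
    by (simp add: f2_def N_def F_square e_def right_diff_distrib)
qed

lemma tendsto_F: "(F \<longlongrightarrow> 0) at_top"
  unfolding F_def[abs_def] using p1
  by (intro tendsto_zero_powrI[OF lim0 tendsto_const]) (auto intro: always_eventually less_imp_le pos)

lemma tendsto_e: "(e \<longlongrightarrow> 0) at_top"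
  unfolding e_def[abs_def] using pq
  by (intro tendsto_zero_powrI[OF lim0 tendsto_const]) (auto intro: always_eventually less_imp_le pos)

lemma tendsto_s: "(s \<longlongrightarrow> 2 / (p + 1)) at_top"
proof -
  have "(s \<longlongrightarrow> 2 / (p + 1) - 2 / (q + 1) * 0) at_top"
    unfolding s_def[abs_def] by (intro tendsto_intros tendsto_e)
  then show ?thesis by simp
qed

text \<open>By the energy identity the derivative of 1/F is (p-1)/2 times the root of
  \<open>s\<close>, which tends to \<open>k\<close>. So 1/F grows like k x by l'Hospital's
  rule.\<close>

lemma tendsto_xF: "((\<lambda>x. x * F x) \<longlongrightarrow> 1 / k) at_top"
proof -
  have D: "((\<lambda>x. 1 / F x) has_real_derivative (p - 1) / 2 * sqrt (s x)) (at x)" if "0 < x" for x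
  proof -
    have d: "((\<lambda>x. f x powr (- ((p - 1) / 2))) has_real_derivative
        - ((p - 1) / 2) * f x powr (- ((p - 1) / 2) - 1) * f1 x) (at x)"
      by (rule DERIV_chain2[OF has_real_derivative_powr[OF pos] D_f])
    have "f x powr (- ((p - 1) / 2) - 1) = 1 / (F x * f x)"
      unfolding powr_diff powr_minus F_def using pos[of x] by (simp add: divide_simps)
    then have 1: "- ((p - 1) / 2) * f x powr (- ((p - 1) / 2) - 1) * f1 x = (p - 1) / 2 * sqrt (s x)"
      unfolding f1_eq[OF that] using pos[of x] F_pos[of x] by simp
    have 2: "(\<lambda>x. f x powr (- ((p - 1) / 2))) = (\<lambda>x. 1 / F x)"
      by (simp add: F_def powr_minus divide_simps)
    show ?thesis
      using d unfolding 1 2 .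
  qed
  have "((\<lambda>x. (1 / F x) / x) \<longlongrightarrow> k) at_top"
  proof (rule lhospital_at_top_at_top)
    show "LIM x at_top. x :> at_top"
      by (rule filterlim_ident)
    show "\<forall>\<^sub>F x in at_top. ((\<lambda>x. 1 / F x) has_real_derivative (p - 1) / 2 * sqrt (s x)) (at x)"
      using eventually_gt_at_top[of 0] by eventually_elim (rule D)
    show "\<forall>\<^sub>F x in at_top. ((\<lambda>x::real. x) has_real_derivative 1) (at x)"
      by simp
    show "((\<lambda>x. (p - 1) / 2 * sqrt (s x) / 1) \<longlongrightarrow> k) at_top"
      unfolding k_def by (auto intro!: tendsto_intros tendsto_s)
  qed auto
  then have "((\<lambda>x. 1 / ((1 / F x) / x)) \<longlongrightarrow> 1 / k) at_top"
    using k_pos by (intro tendsto_intros) auto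
  then show ?thesis
    by (simp add: mult.commute)
qed

lemma tendsto_xf: "((\<lambda>x. f x * x powr a) \<longlongrightarrow> (1 / k) powr a) at_top"
proof -
  have "((\<lambda>x. (x * F x) powr a) \<longlongrightarrow> (1 / k) powr a) at_top"
    using k_pos by (intro tendsto_intros tendsto_xF) auto
  moreover have "\<forall>\<^sub>F x in at_top. (x * F x) powr a = f x * x powr a"
    using eventually_gt_at_top[of 0]
  proof eventually_elim
    case (elim x)
    have "(p - 1) / 2 * a = 1"
      using p1 by (simp add: a_def)
    then have "(F x) powr a = f x"
      unfolding F_def powr_powr using pos[of x] by simp
    then show ?case
      using elim F_pos[of x] by (simp add: powr_mult)
  qed
  ultimately show ?thesis
    by (rule Lim_transform_eventually)
qed

text \<open>The quotient of \<open>num (f x)\<close> by f^2, with limit 1/2.\<close>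

definition w :: "real \<Rightarrow> real" where
  "w x = 1 / 2 - c * (F x)\<^sup>2 * (1 - e x)"

lemma num_w: "num (f x) = (f x)\<^sup>2 * w x"
  by (simp add: num_f f2_eq w_def power2_eq_square algebra_simps)

lemma tendsto_w: "(w \<longlongrightarrow> 1 / 2) at_top"
proof -
  have "(w \<longlongrightarrow> 1 / 2 - c * 0\<^sup>2 * (1 - 0)) at_top"
    unfolding w_def[abs_def] by (intro tendsto_intros tendsto_F tendsto_e)
  then show ?thesis by simp
qed

definition L :: real where
  "L = ((1 / 2) / ((1 / k)\<^sup>2 * (2 / (p + 1)))) / 3"

lemma L_pos: "0 < L"
  using k_pos p1 by (simp add: L_def)

lemma tendsto_inverse_square: "((\<lambda>x::real. 1 / x\<^sup>2) \<longlongrightarrow> 0) at_top"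
  by (intro tendsto_divide_0[OF tendsto_const] filterlim_at_top_imp_at_infinity
      filterlim_pow_at_top filterlim_ident) simp

text \<open>Here R - c equals w / (F^2 s), and F behaves like 1/(k x), so \<open>R\<close> grows
  like x^2.\<close>

lemma tendsto_I: "((\<lambda>x. I x / x ^ 3) \<longlongrightarrow> L) at_top"
proof (rule lhospital_at_top_at_top)
  show "LIM x at_top. (x::real) ^ 3 :> at_top"
    by (intro filterlim_pow_at_top filterlim_ident) simp
  show "\<forall>\<^sub>F x in at_top. 3 * (x::real)\<^sup>2 \<noteq> 0"
    using eventually_gt_at_top[of 0] by eventually_elim simp
  show "\<forall>\<^sub>F x in at_top. (I has_real_derivative R x) (at x)"
    by (simp add: D_I)
  show "\<forall>\<^sub>F x in at_top. ((\<lambda>x::real. x ^ 3) has_real_derivative 3 * x\<^sup>2) (at x)"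
    by (intro always_eventually allI) (auto intro!: derivative_eq_intros)
  have "((\<lambda>x. (c * (1 / x\<^sup>2) + w x / ((x * F x)\<^sup>2 * s x)) / 3) \<longlongrightarrow>
      (c * 0 + (1 / 2) / ((1 / k)\<^sup>2 * (2 / (p + 1)))) / 3) at_top"
    using k_pos p1
    by (intro tendsto_intros tendsto_w tendsto_s tendsto_xF tendsto_inverse_square) auto
  moreover have "\<forall>\<^sub>F x in at_top. (c * (1 / x\<^sup>2) + w x / ((x * F x)\<^sup>2 * s x)) / 3 = R x / (3 * x\<^sup>2)"
    using eventually_gt_at_top[of 0]
  proof eventually_elim
    case (elim x)
    have "R x = c + w x / ((F x)\<^sup>2 * s x)"
      using elim pos[of x] by (simp add: R_def num_w f1_square)
    then show ?case
      by (simp add: power_mult_distrib add_divide_distrib divide_divide_eq_left mult_ac)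
  qed
  ultimately have "((\<lambda>x. R x / (3 * x\<^sup>2)) \<longlongrightarrow>
      (c * 0 + (1 / 2) / ((1 / k)\<^sup>2 * (2 / (p + 1)))) / 3) at_top"
    by (rule Lim_transform_eventually)
  then show "((\<lambda>x. R x / (3 * x\<^sup>2)) \<longlongrightarrow> L) at_top"
    by (simp add: L_def)
qed

text \<open>In u = f1 I - c f the first term has order x^(-a-1) x^3 and is negative; the second has
  order x^(-a), smaller by x^2.\<close>

lemma u_asymp: "asymp_const u (\<lambda>x. - (x powr (- 2 / (p - 1) + 2)))"
proof -
  let ?A = "(1 / k) powr a"
  let ?l = "?A * (1 / k) * sqrt (2 / (p + 1)) * L"
  have "((\<lambda>x. (f x * x powr a) * (x * F x) * sqrt (s x) * (I x / x ^ 3)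
      + c * (f x * x powr a) * (1 / x\<^sup>2)) \<longlongrightarrow> ?l + c * ?A * 0) at_top"
    by (intro tendsto_intros tendsto_xf tendsto_xF tendsto_s tendsto_I tendsto_inverse_square)
  moreover have "\<forall>\<^sub>F x in at_top. (f x * x powr a) * (x * F x) * sqrt (s x) * (I x / x ^ 3)
      + c * (f x * x powr a) * (1 / x\<^sup>2) = u x / - (x powr (- 2 / (p - 1) + 2))"
    using eventually_gt_at_top[of 0]
  proof eventually_elim
    case (elim x)
    have 1: "x powr (- 2 / (p - 1) + 2) = x\<^sup>2 / x powr a"
      unfolding powr_add using elim by (simp add: a_def powr_minus divide_inverse powr_numeral)
    \<comment> \<open>Pure algebra, with y, b, d, r, i standing for f(x), x^a, F(x), the root of
      s(x) and I(x).\<close>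
    have "y * b * (x * d) * r * (i / x ^ 3) + c * (y * b) * (1 / x\<^sup>2)
        = (- (y * d * r) * i - c * y) / - (x\<^sup>2 / b)" if "b \<noteq> 0" for y b d r i :: real
      using that elim by (simp add: field_simps eval_nat_numeral)
    then show ?case
      unfolding 1 u_def f1_eq[OF elim] by this (use elim in simp)
  qed
  ultimately have "((\<lambda>x. u x / - (x powr (- 2 / (p - 1) + 2))) \<longlongrightarrow> ?l + c * ?A * 0) at_top"
    by (rule Lim_transform_eventually)
  moreover have "0 < ?l"
    using k_pos L_pos p1 by simp
  ultimately show ?thesis
    unfolding asymp_const_def by auto
qed

text \<open>Both terms of \<open>u1_eq\<close> have order x^(-a+1) with opposite signs. The limit
  \<open>?l\<close> equals \<open>?A\<close> times (2-p)/6, which vanishes for p = 2, so the result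
  is only an upper bound.\<close>

lemma u1_bigo: "u1 \<in> O[at_top](\<lambda>x. x powr (- 2 / (p - 1) + 1))"
proof (rule bigoI_tendsto)
  let ?A = "(1 / k) powr a"
  let ?l = "?A * (1 / k)\<^sup>2 * (1 - 0) * L - ?A * (1 / 2) / ((1 / k) * sqrt (2 / (p + 1)))"
  have "((\<lambda>x. (f x * x powr a) * (x * F x)\<^sup>2 * (1 - e x) * (I x / x ^ 3)
      - (f x * x powr a) * w x / ((x * F x) * sqrt (s x))) \<longlongrightarrow> ?l) at_top"
    using k_pos p1
    by (intro tendsto_intros tendsto_xf tendsto_xF tendsto_s tendsto_I tendsto_e tendsto_w) auto
  moreover have "\<forall>\<^sub>F x in at_top. (f x * x powr a) * (x * F x)\<^sup>2 * (1 - e x) * (I x / x ^ 3)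
      - (f x * x powr a) * w x / ((x * F x) * sqrt (s x)) = u1 x / x powr (- 2 / (p - 1) + 1)"
    using eventually_gt_at_top[of 0]
  proof eventually_elim
    case (elim x)
    have 1: "x powr (- 2 / (p - 1) + 1) = x / x powr a"
      unfolding powr_add using elim by (simp add: a_def powr_minus divide_inverse)
    have 2: "u1 x = f x * (F x)\<^sup>2 * (1 - e x) * I x - f x * w x / (F x * sqrt (s x))"
    proof -
      have "u1 x = f2 x * I x + num (f x) / f1 x"
        using u1_eq[of x] elim by (simp add: num_f)
      also have "num (f x) / f1 x = - (f x * w x / (F x * sqrt (s x)))"
        using pos[of x] by (simp add: num_w f1_eq[OF elim] power2_eq_square)
      finally show ?thesis
        by (simp add: f2_eq)
    qed
    have "y * b * (x * d)\<^sup>2 * g * (i / x ^ 3) - y * b * v / (x * d * r)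
        = (y * d\<^sup>2 * g * i - y * v / (d * r)) / (x / b)"
      if "b \<noteq> 0" "d \<noteq> 0" "r \<noteq> 0" for y b d g i v r :: real
      using that elim by (simp add: field_simps eval_nat_numeral)
    then show ?case
      unfolding 1 2 by this (use elim s_pos[OF elim] F_pos[of x] in simp_all)
  qed
  ultimately show "((\<lambda>x. u1 x / x powr (- 2 / (p - 1) + 1)) \<longlongrightarrow> ?l) at_top"
    by (rule Lim_transform_eventually)
  show "\<forall>\<^sub>F x in at_top. x powr (- 2 / (p - 1) + 1) \<noteq> 0"
    using eventually_gt_at_top[of 0] by eventually_elim simp
qed

end

subsection \<open>Dependence on the frequency\<close>

text \<open>Gronwall's inequality for a family: vanishing initial values and arbitrarily small
  inhomogeneities force uniform convergence to 0 on a compact interval.\<close>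

lemma uniform_limit_gronwall:
  fixes w w1 w2 :: "'i \<Rightarrow> real \<Rightarrow> real"
  assumes D: "\<forall>\<^sub>F i in Fl. \<forall>x. (w i has_real_derivative w1 i x) (at x)"
      "\<forall>\<^sub>F i in Fl. \<forall>x. (w1 i has_real_derivative w2 i x) (at x)"
    and w1: "\<forall>\<^sub>F i in Fl. w1 i 0 = 0"
    and w0: "((\<lambda>i. w i 0) \<longlongrightarrow> 0) Fl"
    and bound: "\<And>e. 0 < e \<Longrightarrow> \<forall>\<^sub>F i in Fl. \<forall>x\<in>{0..X}. \<bar>w2 i x\<bar> \<le> K * \<bar>w i x\<bar> + e"
    and "0 \<le> K"
  shows "uniform_limit {0..X} w (\<lambda>_. 0) Fl"
proof (rule uniform_limitI)
  fix r :: real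
  assume "0 < r"
  define T where "T = exp ((K + 2) * X)"
  \<comment> \<open>Chosen so that (e^2 + e^2) T = r^2 / 2, strictly below r^2.\<close>
  define e where "e = r / (2 * sqrt T)"
  have "0 < T"
    by (simp add: T_def)
  then have "0 < e" and eT: "e\<^sup>2 * T = r\<^sup>2 / 4"
    using \<open>0 < r\<close> by (simp_all add: e_def power_divide power_mult_distrib)
  have "\<forall>\<^sub>F i in Fl. \<bar>w i 0\<bar> < e"
    using tendstoD[OF w0 \<open>0 < e\<close>] by (simp add: dist_real_def)
  then show "\<forall>\<^sub>F i in Fl. \<forall>x\<in>{0..X}. dist (w i x) 0 < r"
    using D w1 bound[OF \<open>0 < e\<close>]
  proof eventually_elim
    case (elim i)
    show ?case
    proof
      fix x
      assume x: "x \<in> {0..X}"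
      have "(w i x)\<^sup>2 \<le> ((w i 0)\<^sup>2 + e\<^sup>2) * exp ((K + 2) * x)"
        using elim x \<open>0 \<le> K\<close> by (intro second_order_gronwall[of "w i" "w1 i" "w2 i" X]) auto
      also have "\<dots> \<le> (e\<^sup>2 + e\<^sup>2) * T"
        unfolding T_def using x \<open>0 \<le> K\<close> elim(1) \<open>0 < e\<close>
        by (intro mult_mono add_right_mono) (auto simp: abs_le_square_iff[symmetric] intro: mult_left_mono)
      also have "\<dots> = r\<^sup>2 / 2"
        using eT by argo
      also have "\<dots> < r\<^sup>2"
        using \<open>0 < r\<close> by simp
      finally show "dist (w i x) 0 < r"
        using power2_less_imp_less[of "\<bar>w i x\<bar>" r] \<open>0 < r\<close> by (simp add: dist_real_def)
    qed
  qed
qed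

text \<open>The mean value theorem in a form independent of the order of the two points, which may
  also coincide, as two profiles can cross.\<close>

lemma (in exponents) N_mvt:
  assumes "0 < s" "0 < t"
  shows "\<exists>\<xi>. min s t \<le> \<xi> \<and> \<xi> \<le> max s t \<and> N s - N t = dN \<xi> * (s - t)"
proof (cases s t rule: linorder_cases)
  case less
  then obtain \<xi> where "s < \<xi>" "\<xi> < t" "N t - N s = (t - s) * dN \<xi>"
    using MVT2[of s t N dN] DERIV_N assms by auto
  then show ?thesis
    using less by (intro exI[of _ \<xi>]) (auto simp: algebra_simps)
next
  case greater
  then obtain \<xi> where "t < \<xi>" "\<xi> < s" "N s - N t = (s - t) * dN \<xi>"
    using MVT2[of t s N dN] DERIV_N assms by auto
  then show ?thesis
    using greater by (intro exI[of _ \<xi>]) (auto simp: algebra_simps)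
qed auto

lemma (in exponents) dN_bounded:
  obtains C where "0 \<le> C" "\<And>s. 0 \<le> s \<Longrightarrow> s \<le> B \<Longrightarrow> \<bar>dN s\<bar> \<le> C"
proof -
  have "compact (dN ` {0..B})"
    by (intro compact_continuous_image continuous_on_subset[OF continuous_on_dN]) auto
  then obtain C where "0 < C" "\<forall>y\<in>dN ` {0..B}. norm y \<le> C"
    using bounded_pos compact_imp_bounded by metis
  then show ?thesis
    by (intro that[of C]) auto
qed

locale ground_states = exponents +
  fixes \<phi> :: "real \<Rightarrow> real \<Rightarrow> real"
  assumes gs: "0 \<le> \<omega> \<Longrightarrow> ground_state p q \<omega> (\<phi> \<omega>)"
begin

lemma profile: "0 \<le> \<omega> \<Longrightarrow> profile p q \<omega> (\<phi> \<omega>)"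
  by unfold_locales (auto intro: gs)

abbreviation M :: "real \<Rightarrow> real" where
  "M \<omega> \<equiv> \<phi> \<omega> 0"

abbreviation u :: "real \<Rightarrow> real \<Rightarrow> real" where
  "u \<omega> \<equiv> profile.u p q \<omega> (\<phi> \<omega>)"

abbreviation u1 :: "real \<Rightarrow> real \<Rightarrow> real" where
  "u1 \<omega> \<equiv> profile.u1 p q \<omega> (\<phi> \<omega>)"

lemmas pos = profile.pos[OF profile]
lemmas le_M = profile.f_le_top[OF profile]
lemmas G_M = profile.G_top[OF profile]
lemmas dG_M = profile.dG_top[OF profile]

section \<open>The maximum as a function of the frequency\<close>

lemma M_mono:
  assumes "0 \<le> \<omega>" "\<omega> \<le> \<omega>'"
  shows "M \<omega> \<le> M \<omega>'"
proof (rule ccontr)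
  assume "\<not> M \<omega> \<le> M \<omega>'"
  then have "G (M \<omega>') < G (M \<omega>)"
    using assms G_M[of \<omega>] by (intro G_less pos) auto
  then show False
    using assms by (simp add: G_M)
qed

lemma M_G:
  assumes "0 < s" "0 \<le> G s"
  shows "M (G s) = s"
  using G_less[OF assms(1), of "M (G s)"] G_less[OF pos[OF assms(2)], of 0 s] G_M[OF assms(2)] assms
  by (cases "M (G s)" s rule: linorder_cases) auto

text \<open>On a compact interval of heights \<open>G\<close> is continuous with left inverse
  \<open>M\<close>, so \<open>M\<close> is continuous on the image. The filter within the half-line
  treats \<omega> = 0 and \<omega> > 0 alike.\<close>

lemma tendsto_M:
  assumes "0 \<le> \<omega>"
  shows "(M \<longlongrightarrow> M \<omega>) (at \<omega> within {0..})"
proof -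
  let ?S = "{M 0..M (\<omega> + 1)}"
  have S: "0 < s" if "s \<in> ?S" for s
    using that pos[of 0 0] by auto
  have "0 \<le> G s" if "s \<in> ?S" for s
  proof (cases "s = M 0")
    case False
    then have "G (M 0) < G s"
      using that G_M[of 0] by (intro G_less pos) auto
    then show ?thesis
      using G_M[of 0] by simp
  qed (simp add: G_M)
  then have inv: "\<forall>s\<in>?S. M (G s) = s"
    using M_G S by blast
  have "continuous_on ?S G"
    by (intro continuous_at_imp_continuous_on ballI DERIV_isCont[OF DERIV_G] S)
  then have "continuous_on (G ` ?S) M"
    using inv by (rule continuous_on_inv[OF _ compact_Icc])
  moreover have "{0..\<omega> + 1} \<subseteq> G ` ?S"
  proof
    fix v
    assume v: "v \<in> {0..\<omega> + 1}"
    show "v \<in> G ` ?S"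
    proof (rule image_eqI)
      show "v = G (M v)"
        using v G_M[of v] by simp
      show "M v \<in> ?S"
        using v M_mono[of 0 v] M_mono[of v "\<omega> + 1"] by simp
    qed
  qed
  ultimately have "continuous_on {0..\<omega> + 1} M"
    by (rule continuous_on_subset)
  then have "(M \<longlongrightarrow> M \<omega>) (at \<omega> within {0..\<omega> + 1})"
    using assms unfolding continuous_on_def by simp
  moreover have "at \<omega> within {0..\<omega> + 1} = at \<omega> within {0..}"
  proof (rule at_within_nhd)
    show "{0..\<omega> + 1} \<inter> {..<\<omega> + 1} - {\<omega>} = {0..} \<inter> {..<\<omega> + 1} - {\<omega>}"
      unfolding set_eq_iff Diff_iff Int_iff atLeastAtMost_iff lessThan_iff atLeast_iff
      by (blast intro: less_imp_le)
  qed simp_all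
  ultimately show ?thesis by simp
qed

lemma at_within_nonneg: "0 < \<omega> \<Longrightarrow> at \<omega> within {0..} = at (\<omega>::real)"
  by (rule at_within_interior) simp

lemma D_M:
  assumes "0 < \<omega>"
  shows "(M has_real_derivative 1 / dG (M \<omega>)) (at \<omega>)"
proof -
  have "(M has_real_derivative inverse (dG (M \<omega>))) (at \<omega>)"
  proof (rule DERIV_inverse_function)
    show "(G has_real_derivative dG (M \<omega>)) (at (M \<omega>))"
      using pos[of \<omega> 0] assms by (intro DERIV_G) auto
    show "dG (M \<omega>) \<noteq> 0"
      using dG_M[of \<omega>] assms by auto
    show "0 < \<omega>" "\<omega> < \<omega> + 1"
      using assms by auto
    show "isCont M \<omega>"
      using tendsto_M[of \<omega>] assms by (simp add: isCont_def at_within_nonneg)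
  qed (auto intro: G_M)
  then show ?thesis
    by (simp add: inverse_eq_divide)
qed

section \<open>Continuous dependence of the profile\<close>

lemma eventually_near:
  fixes \<omega> :: real
  assumes "0 \<le> \<omega>"
  shows "\<forall>\<^sub>F \<omega>' in at \<omega> within {0..}. 0 \<le> \<omega>' \<and> \<omega>' \<le> \<omega> + 1"
proof -
  have "\<forall>\<^sub>F \<omega>' in at \<omega> within {0..}. \<omega>' < \<omega> + 1"
    using order_tendstoD(2)[OF tendsto_ident_at, of \<omega> "\<omega> + 1" "{0..}"] by simp
  moreover have "\<forall>\<^sub>F \<omega>' in at \<omega> within {0..}. \<omega>' \<in> {0..}"
    by (simp add: eventually_at_filter)
  ultimately show ?thesis
    by eventually_elim auto
qed

text \<open>By \<open>N_mvt\<close> the difference of two profiles solves a linear equation with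
  bounded coefficient and inhomogeneity at most |\<omega>' - \<omega>| B, where \<open>B\<close>
  bounds all nearby profiles. The initial values converge by \<open>tendsto_M\<close>.\<close>

lemma uniform_limit_\<phi>:
  assumes "0 \<le> \<omega>"
  shows "uniform_limit {0..X} \<phi> (\<phi> \<omega>) (at \<omega> within {0..})"
proof -
  interpret P: profile p q \<omega> "\<phi> \<omega>"
    by (rule profile[OF assms])
  define B where "B = M (\<omega> + 1)"
  obtain C where "0 \<le> C" and C: "\<And>s. 0 \<le> s \<Longrightarrow> s \<le> B \<Longrightarrow> \<bar>dN s\<bar> \<le> C"
    using dN_bounded[of B] by blast
  have "uniform_limit {0..X} (\<lambda>\<omega>' x. \<phi> \<omega>' x - \<phi> \<omega> x) (\<lambda>_. 0) (at \<omega> within {0..})"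
  proof (rule uniform_limit_gronwall)
    show "\<forall>\<^sub>F \<omega>' in at \<omega> within {0..}. \<forall>x. ((\<lambda>x. \<phi> \<omega>' x - \<phi> \<omega> x) has_real_derivative
        deriv (\<phi> \<omega>') x - deriv (\<phi> \<omega>) x) (at x)"
      using eventually_near[OF assms]
      by eventually_elim (auto intro!: derivative_intros P.D_f profile.D_f[OF profile])
    show "\<forall>\<^sub>F \<omega>' in at \<omega> within {0..}. \<forall>x. ((\<lambda>x. deriv (\<phi> \<omega>') x - deriv (\<phi> \<omega>) x) has_real_derivative
        profile.f2 p q \<omega>' (\<phi> \<omega>') x - P.f2 x) (at x)"
      using eventually_near[OF assms]
      by eventually_elim (auto intro!: derivative_intros P.D_f1 profile.D_f1[OF profile])
    show "\<forall>\<^sub>F \<omega>' in at \<omega> within {0..}. deriv (\<phi> \<omega>') 0 - deriv (\<phi> \<omega>) 0 = 0"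
      using eventually_near[OF assms]
      by eventually_elim (auto simp: P.f1_0 profile.f1_0[OF profile])
    show "((\<lambda>\<omega>'. M \<omega>' - M \<omega>) \<longlongrightarrow> 0) (at \<omega> within {0..})"
      using tendsto_M[OF assms] by (simp add: LIM_zero)
    show "0 \<le> \<omega> + C"
      using assms \<open>0 \<le> C\<close> by simp
    fix e :: real
    assume "0 < e"
    have "((\<lambda>\<omega>'. \<bar>\<omega>' - \<omega>\<bar> * B) \<longlongrightarrow> \<bar>\<omega> - \<omega>\<bar> * B) (at \<omega> within {0..})"
      by (intro tendsto_intros)
    then have "\<forall>\<^sub>F \<omega>' in at \<omega> within {0..}. \<bar>\<omega>' - \<omega>\<bar> * B < e"
      using \<open>0 < e\<close> by (intro order_tendstoD(2)) auto
    then show "\<forall>\<^sub>F \<omega>' in at \<omega> within {0..}. \<forall>x\<in>{0..X}. \<bar>profile.f2 p q \<omega>' (\<phi> \<omega>') x - P.f2 x\<bar>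
        \<le> (\<omega> + C) * \<bar>\<phi> \<omega>' x - \<phi> \<omega> x\<bar> + e"
      using eventually_near[OF assms]
    proof eventually_elim
      case (elim \<omega>')
      then have \<omega>': "0 \<le> \<omega>'" "\<omega>' \<le> \<omega> + 1"
        by auto
      show ?case
      proof
        fix x
        have B: "\<phi> \<omega>' x \<le> B" "\<phi> \<omega> x \<le> B"
          using le_M[OF \<omega>'(1), of x] le_M[OF assms, of x] M_mono[OF \<omega>'] M_mono[OF assms, of "\<omega> + 1"]
          by (auto simp: B_def)
        obtain \<xi> where \<xi>: "min (\<phi> \<omega>' x) (\<phi> \<omega> x) \<le> \<xi>" "\<xi> \<le> max (\<phi> \<omega>' x) (\<phi> \<omega> x)"
          "N (\<phi> \<omega>' x) - N (\<phi> \<omega> x) = dN \<xi> * (\<phi> \<omega>' x - \<phi> \<omega> x)"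
          using N_mvt[OF pos[OF \<omega>'(1)] pos[OF assms]] by blast
        then have "\<bar>dN \<xi>\<bar> \<le> C"
          using B pos[OF \<omega>'(1), of x] pos[OF assms, of x] by (intro C) auto
        have "profile.f2 p q \<omega>' (\<phi> \<omega>') x - P.f2 x
            = (\<omega>' - \<omega>) * \<phi> \<omega>' x + (\<omega> + dN \<xi>) * (\<phi> \<omega>' x - \<phi> \<omega> x)"
          using \<xi>(3) by (simp add: P.f2_def profile.f2_def[OF profile[OF \<omega>'(1)]] algebra_simps)
        also have "\<bar>\<dots>\<bar> \<le> \<bar>\<omega>' - \<omega>\<bar> * \<phi> \<omega>' x + \<bar>\<omega> + dN \<xi>\<bar> * \<bar>\<phi> \<omega>' x - \<phi> \<omega> x\<bar>"
          using abs_triangle_ineq pos[OF \<omega>'(1), of x] by (metis abs_mult abs_of_pos)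
        also have "\<dots> \<le> \<bar>\<omega>' - \<omega>\<bar> * B + (\<omega> + C) * \<bar>\<phi> \<omega>' x - \<phi> \<omega> x\<bar>"
          using B \<open>\<bar>dN \<xi>\<bar> \<le> C\<close> assms by (intro add_mono mult_left_mono mult_right_mono) auto
        finally show "\<bar>profile.f2 p q \<omega>' (\<phi> \<omega>') x - P.f2 x\<bar> \<le> (\<omega> + C) * \<bar>\<phi> \<omega>' x - \<phi> \<omega> x\<bar> + e"
          using elim by linarith
      qed
    qed
  qed
  then show ?thesis
    by (simp add: uniform_limit_iff dist_real_def)
qed

text \<open>All intermediate \<open>s\<close> are covered because the point supplied by
  \<open>N_mvt\<close> is unknown; uniform continuity of \<open>dN\<close> gives the
  estimate.\<close>

lemma dN_close:
  assumes "0 \<le> \<omega>" "0 < e"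
  shows "\<forall>\<^sub>F \<omega>' in at \<omega> within {0..}. \<forall>x\<in>{0..X}. \<forall>s. min (\<phi> \<omega>' x) (\<phi> \<omega> x) \<le> s \<longrightarrow>
    s \<le> max (\<phi> \<omega>' x) (\<phi> \<omega> x) \<longrightarrow> \<bar>dN s - dN (\<phi> \<omega> x)\<bar> < e"
proof -
  define B where "B = M (\<omega> + 1)"
  have "uniformly_continuous_on {0..B} dN"
    by (intro compact_uniformly_continuous continuous_on_subset[OF continuous_on_dN]) auto
  then obtain d where "0 < d" and d: "\<And>s t. s \<in> {0..B} \<Longrightarrow> t \<in> {0..B} \<Longrightarrow> \<bar>t - s\<bar> < d \<Longrightarrow> \<bar>dN t - dN s\<bar> < e"
    using \<open>0 < e\<close> unfolding uniformly_continuous_on_def dist_real_def by metis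
  have "\<forall>\<^sub>F \<omega>' in at \<omega> within {0..}. \<forall>x\<in>{0..X}. dist (\<phi> \<omega>' x) (\<phi> \<omega> x) < d"
    using uniform_limit_\<phi>[OF assms(1)] \<open>0 < d\<close> by (rule uniform_limitD)
  then show ?thesis
    using eventually_near[OF assms(1)]
  proof eventually_elim
    case (elim \<omega>')
    then have \<omega>': "0 \<le> \<omega>'" "\<omega>' \<le> \<omega> + 1"
      by auto
    show ?case
    proof (intro ballI allI impI)
      fix x s
      assume x: "x \<in> {0..X}" and s: "min (\<phi> \<omega>' x) (\<phi> \<omega> x) \<le> s" "s \<le> max (\<phi> \<omega>' x) (\<phi> \<omega> x)"
      have "\<phi> \<omega>' x \<le> B" "\<phi> \<omega> x \<le> B"
        using le_M[OF \<omega>'(1), of x] le_M[OF assms(1), of x] M_mono[OF \<omega>'] M_mono[OF assms(1), of "\<omega> + 1"]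
        by (auto simp: B_def)
      moreover have "\<bar>\<phi> \<omega>' x - \<phi> \<omega> x\<bar> < d"
        using elim x by (auto simp: dist_real_def)
      ultimately show "\<bar>dN s - dN (\<phi> \<omega> x)\<bar> < e"
        using s pos[OF \<omega>'(1), of x] pos[OF assms(1), of x] by (intro d) auto
    qed
  qed
qed

section \<open>The derivative in the frequency and its limit at zero\<close>

lemma u_bounded:
  assumes "0 \<le> \<omega>"
  obtains C where "0 < C" "\<And>x. x \<in> {0..X} \<Longrightarrow> \<bar>u \<omega> x\<bar> \<le> C"
proof -
  have "compact (u \<omega> ` {0..X})"
    by (intro compact_continuous_image profile.continuous_u[OF profile[OF assms]]) auto
  then obtain C where "0 < C" "\<forall>y\<in>u \<omega> ` {0..X}. norm y \<le> C"
    using bounded_pos compact_imp_bounded by metis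
  then show ?thesis
    by (intro that[of C]) auto
qed

text \<open>Gronwall's inequality is applied to the difference quotient minus
  \<open>u \<omega>\<close>. Its value at 0 vanishes in the limit because
  \<open>u \<omega> 0\<close> is the derivative of \<open>M\<close>.\<close>

lemma D_\<phi>_nonneg:
  assumes "0 < \<omega>" "0 \<le> x"
  shows "((\<lambda>\<omega>. \<phi> \<omega> x) has_real_derivative u \<omega> x) (at \<omega>)"
proof -
  have nonneg: "0 \<le> \<omega>"
    using assms by simp
  interpret P: profile p q \<omega> "\<phi> \<omega>"
    by (rule profile[OF nonneg])
  define B where "B = M (\<omega> + 1)"
  obtain C where "0 \<le> C" and C: "\<And>s. 0 \<le> s \<Longrightarrow> s \<le> B \<Longrightarrow> \<bar>dN s\<bar> \<le> C"
    using dN_bounded[of B] by blast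
  obtain C' where "0 < C'" and C': "\<And>y. y \<in> {0..x} \<Longrightarrow> \<bar>u \<omega> y\<bar> \<le> C'"
    using u_bounded[OF nonneg] by blast
  note near = eventually_near[OF nonneg]
  have "uniform_limit {0..x} (\<lambda>\<omega>' y. (\<phi> \<omega>' y - \<phi> \<omega> y) / (\<omega>' - \<omega>) - u \<omega> y) (\<lambda>_. 0) (at \<omega> within {0..})"
  proof (rule uniform_limit_gronwall)
    show "\<forall>\<^sub>F \<omega>' in at \<omega> within {0..}. \<forall>y. ((\<lambda>y. (\<phi> \<omega>' y - \<phi> \<omega> y) / (\<omega>' - \<omega>) - u \<omega> y)
        has_real_derivative (deriv (\<phi> \<omega>') y - deriv (\<phi> \<omega>) y) / (\<omega>' - \<omega>) - u1 \<omega> y) (at y)"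
      using near
      by eventually_elim
        (auto intro!: DERIV_diff DERIV_cdivide P.D_f P.D_u profile.D_f[OF profile])
    show "\<forall>\<^sub>F \<omega>' in at \<omega> within {0..}. \<forall>y. ((\<lambda>y. (deriv (\<phi> \<omega>') y - deriv (\<phi> \<omega>) y) / (\<omega>' - \<omega>) - u1 \<omega> y)
        has_real_derivative (profile.f2 p q \<omega>' (\<phi> \<omega>') y - P.f2 y) / (\<omega>' - \<omega>) - P.u2 y) (at y)"
      using near
      by eventually_elim
        (auto intro!: DERIV_diff DERIV_cdivide P.D_f1 P.D_u1 profile.D_f1[OF profile])
    show "\<forall>\<^sub>F \<omega>' in at \<omega> within {0..}. (deriv (\<phi> \<omega>') 0 - deriv (\<phi> \<omega>) 0) / (\<omega>' - \<omega>) - u1 \<omega> 0 = 0"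
      using near
      by eventually_elim (simp add: P.f1_0 P.u1_0 profile.f1_0[OF profile])
    have "((\<lambda>\<omega>'. (M \<omega>' - M \<omega>) / (\<omega>' - \<omega>)) \<longlongrightarrow> u \<omega> 0) (at \<omega>)"
      using D_M[OF assms(1)] by (simp add: has_field_derivative_iff P.u_0)
    then show "((\<lambda>\<omega>'. (M \<omega>' - M \<omega>) / (\<omega>' - \<omega>) - u \<omega> 0) \<longlongrightarrow> 0) (at \<omega> within {0..})"
      using assms by (simp add: LIM_zero at_within_nonneg)
    show "0 \<le> \<omega> + C"
      using assms \<open>0 \<le> C\<close> by simp
    fix e :: real
    assume "0 < e"
    then have "0 < e / (2 * C')" "0 < e / 2"
      using \<open>0 < C'\<close> by auto
    have ne: "\<forall>\<^sub>F \<omega>' in at \<omega> within {0..}. \<omega>' \<noteq> \<omega>"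
      by (simp add: eventually_at_filter)
    have "\<forall>\<^sub>F \<omega>' in at \<omega> within {0..}. \<forall>y\<in>{0..x}. dist (\<phi> \<omega>' y) (\<phi> \<omega> y) < e / 2"
      using uniform_limit_\<phi>[OF nonneg] \<open>0 < e / 2\<close> by (rule uniform_limitD)
    then show "\<forall>\<^sub>F \<omega>' in at \<omega> within {0..}. \<forall>y\<in>{0..x}.
        \<bar>(profile.f2 p q \<omega>' (\<phi> \<omega>') y - P.f2 y) / (\<omega>' - \<omega>) - P.u2 y\<bar>
        \<le> (\<omega> + C) * \<bar>(\<phi> \<omega>' y - \<phi> \<omega> y) / (\<omega>' - \<omega>) - u \<omega> y\<bar> + e"
      using near dN_close[OF nonneg \<open>0 < e / (2 * C')\<close>, of x] ne
    proof eventually_elim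
      case (elim \<omega>')
      then have \<omega>': "0 \<le> \<omega>'" "\<omega>' \<le> \<omega> + 1" and "\<omega>' - \<omega> \<noteq> 0"
        by auto
      show ?case
      proof
        fix y
        assume y: "y \<in> {0..x}"
        let ?w = "(\<phi> \<omega>' y - \<phi> \<omega> y) / (\<omega>' - \<omega>) - u \<omega> y"
        have B: "\<phi> \<omega>' y \<le> B" "\<phi> \<omega> y \<le> B"
          using le_M[OF \<omega>'(1), of y] le_M[OF nonneg, of y] M_mono[OF \<omega>'] M_mono[OF nonneg, of "\<omega> + 1"]
          by (auto simp: B_def)
        obtain \<xi> where \<xi>: "min (\<phi> \<omega>' y) (\<phi> \<omega> y) \<le> \<xi>" "\<xi> \<le> max (\<phi> \<omega>' y) (\<phi> \<omega> y)"
          "N (\<phi> \<omega>' y) - N (\<phi> \<omega> y) = dN \<xi> * (\<phi> \<omega>' y - \<phi> \<omega> y)"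
          using N_mvt[OF pos[OF \<omega>'(1)] pos[OF nonneg]] by blast
        then have "\<bar>dN \<xi>\<bar> \<le> C"
          using B pos[OF \<omega>'(1), of y] pos[OF nonneg, of y] by (intro C) auto
        have "\<bar>dN \<xi> - dN (\<phi> \<omega> y)\<bar> \<le> e / (2 * C')"
          using elim(3) y \<xi>(1,2) by (auto intro: less_imp_le)
        have "profile.f2 p q \<omega>' (\<phi> \<omega>') y - P.f2 y
            = (\<omega>' - \<omega>) * \<phi> \<omega>' y + (\<omega> + dN \<xi>) * (\<phi> \<omega>' y - \<phi> \<omega> y)"
          using \<xi>(3) by (simp add: P.f2_def profile.f2_def[OF profile[OF \<omega>'(1)]] algebra_simps)
        then have "(profile.f2 p q \<omega>' (\<phi> \<omega>') y - P.f2 y) / (\<omega>' - \<omega>)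
            = \<phi> \<omega>' y + (\<omega> + dN \<xi>) * ((\<phi> \<omega>' y - \<phi> \<omega> y) / (\<omega>' - \<omega>))"
          using \<open>\<omega>' - \<omega> \<noteq> 0\<close> by (simp add: add_divide_distrib)
        \<comment> \<open>Subtracting the linearized equation leaves a multiple of \<open>?w\<close>
          and two errors, each at most e/2 because \<open>C'\<close> bounds
          \<open>u \<omega>\<close> on the interval.\<close>
        then have "(profile.f2 p q \<omega>' (\<phi> \<omega>') y - P.f2 y) / (\<omega>' - \<omega>) - P.u2 y
            = (\<omega> + dN \<xi>) * ?w + ((dN \<xi> - dN (\<phi> \<omega> y)) * u \<omega> y + (\<phi> \<omega>' y - \<phi> \<omega> y))"
          by (simp add: P.u2_def P.V_def algebra_simps)
        also have "\<bar>\<dots>\<bar> \<le> \<bar>(\<omega> + dN \<xi>) * ?w\<bar> + (\<bar>(dN \<xi> - dN (\<phi> \<omega> y)) * u \<omega> y\<bar> + \<bar>\<phi> \<omega>' y - \<phi> \<omega> y\<bar>)"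
          by (intro abs_triangle_ineq[THEN order_trans] add_left_mono abs_triangle_ineq)
        also have "\<dots> \<le> (\<omega> + C) * \<bar>?w\<bar> + (e / (2 * C') * C' + e / 2)"
          unfolding abs_mult
          using \<open>\<bar>dN \<xi>\<bar> \<le> C\<close> \<open>\<bar>dN \<xi> - dN (\<phi> \<omega> y)\<bar> \<le> e / (2 * C')\<close> C'[OF y] elim(1) y assms \<open>0 < C'\<close> \<open>0 < e\<close>
          by (intro add_mono mult_mono) (auto simp: dist_real_def intro: less_imp_le)
        also have "\<dots> = (\<omega> + C) * \<bar>?w\<bar> + e"
          using \<open>0 < C'\<close> by simp
        finally show "\<bar>(profile.f2 p q \<omega>' (\<phi> \<omega>') y - P.f2 y) / (\<omega>' - \<omega>) - P.u2 y\<bar> \<le> (\<omega> + C) * \<bar>?w\<bar> + e" .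
      qed
    qed
  qed
  then have "((\<lambda>\<omega>'. (\<phi> \<omega>' x - \<phi> \<omega> x) / (\<omega>' - \<omega>) - u \<omega> x) \<longlongrightarrow> 0) (at \<omega>)"
    using assms by (intro tendsto_uniform_limitI) (auto simp: at_within_nonneg)
  then show ?thesis
    unfolding has_field_derivative_iff by (rule LIM_zero_cancel)
qed

text \<open>Evenness extends the derivative to negative x. The profiles are known to be even only
  for nonnegative frequencies, hence the restriction to a neighbourhood of \<omega>.\<close>

lemma \<eta>_eq_u:
  assumes "0 < \<omega>"
  shows "\<eta> \<phi> \<omega> x = u \<omega> x"
proof -
  have D: "((\<lambda>\<omega>. \<phi> \<omega> \<bar>x\<bar>) has_real_derivative u \<omega> \<bar>x\<bar>) (at \<omega>)"
    by (intro D_\<phi>_nonneg assms) simp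
  have u: "u \<omega> \<bar>x\<bar> = u \<omega> x"
    using profile.u_even[OF profile] assms by (simp add: abs_if)
  have ev: "\<forall>\<^sub>F v in nhds \<omega>. \<phi> v \<bar>x\<bar> = \<phi> v x"
  proof -
    have "\<forall>\<^sub>F v in nhds \<omega>. v \<in> {0<..}"
      using assms by (intro eventually_nhds_in_open) auto
    then show ?thesis
      by eventually_elim (auto simp: abs_if profile.even[OF profile])
  qed
  have "((\<lambda>\<omega>. \<phi> \<omega> x) has_real_derivative u \<omega> x) (at \<omega>)"
    using D by (rule DERIV_cong_ev[OF refl ev u, THEN iffD1])
  then show ?thesis
    unfolding \<eta>_def by (rule DERIV_imp_deriv)
qed

text \<open>Gronwall's inequality for \<open>u \<omega>\<close> minus \<open>u 0\<close>. The
  initial values are 1 / dG(M \<omega>), which converge because \<open>dG\<close> is continuous and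
  positive at \<open>M 0\<close>.\<close>

lemma tendsto_u_nonneg:
  assumes "0 \<le> x"
  shows "((\<lambda>\<omega>. u \<omega> x) \<longlongrightarrow> u 0 x) (at 0 within {0..})"
proof -
  interpret P: profile p q 0 "\<phi> 0"
    by (rule profile) simp
  define B where "B = M 1"
  obtain C where "0 \<le> C" and C: "\<And>s. 0 \<le> s \<Longrightarrow> s \<le> B \<Longrightarrow> \<bar>dN s\<bar> \<le> C"
    using dN_bounded[of B] by blast
  obtain C' where "0 < C'" and C': "\<And>y. y \<in> {0..x} \<Longrightarrow> \<bar>u 0 y\<bar> \<le> C'"
    using u_bounded[of 0 x] by auto
  have near: "\<forall>\<^sub>F \<omega> in at 0 within {0..}. 0 \<le> \<omega> \<and> \<omega> \<le> (1::real)"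
    using eventually_near[of 0] by simp
  have "uniform_limit {0..x} (\<lambda>\<omega> y. u \<omega> y - u 0 y) (\<lambda>_. 0) (at 0 within {0..})"
  proof (rule uniform_limit_gronwall)
    show "\<forall>\<^sub>F \<omega> in at 0 within {0..}. \<forall>y. ((\<lambda>y. u \<omega> y - u 0 y) has_real_derivative
        u1 \<omega> y - u1 0 y) (at y)"
      using near by eventually_elim (auto intro!: DERIV_diff P.D_u profile.D_u[OF profile])
    show "\<forall>\<^sub>F \<omega> in at 0 within {0..}. \<forall>y. ((\<lambda>y. u1 \<omega> y - u1 0 y) has_real_derivative
        profile.u2 p q \<omega> (\<phi> \<omega>) y - P.u2 y) (at y)"
      using near by eventually_elim (auto intro!: DERIV_diff P.D_u1 profile.D_u1[OF profile])
    show "\<forall>\<^sub>F \<omega> in at 0 within {0..}. u1 \<omega> 0 - u1 0 0 = 0"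
      using near by eventually_elim (simp add: P.u1_0 profile.u1_0[OF profile])
    have "isCont dG (M 0)"
      using continuous_on_dG P.pos[of 0] by (simp add: continuous_on_eq_continuous_at)
    then have "((\<lambda>\<omega>. dG (M \<omega>)) \<longlongrightarrow> dG (M 0)) (at 0 within {0..})"
      by (rule isCont_tendsto_compose) (rule tendsto_M, simp)
    then have "((\<lambda>\<omega>. 1 / dG (M \<omega>) - u 0 0) \<longlongrightarrow> 1 / dG (M 0) - u 0 0) (at 0 within {0..})"
      using P.dG_top by (intro tendsto_intros) auto
    moreover have "\<forall>\<^sub>F \<omega> in at 0 within {0..}. 1 / dG (M \<omega>) - u 0 0 = u \<omega> 0 - u 0 0"
      using near by eventually_elim (simp add: profile.u_0[OF profile])
    ultimately show "((\<lambda>\<omega>. u \<omega> 0 - u 0 0) \<longlongrightarrow> 0) (at 0 within {0..})"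
      unfolding P.u_0 by (auto intro: Lim_transform_eventually)
    show "0 \<le> 1 + C"
      using \<open>0 \<le> C\<close> by simp
    fix e :: real
    assume "0 < e"
    then have e: "0 < e / (3 * C')" "0 < e / 3"
      using \<open>0 < C'\<close> by auto
    have "((\<lambda>\<omega>. \<omega>) \<longlongrightarrow> 0) (at 0 within {0..})"
      by (rule tendsto_ident_at)
    then have small: "\<forall>\<^sub>F \<omega> in at 0 within {0..}. \<omega> < e / (3 * C')"
      using e(1) by (rule order_tendstoD(2))
    have "\<forall>\<^sub>F \<omega> in at 0 within {0..}. \<forall>y\<in>{0..x}. dist (\<phi> \<omega> y) (\<phi> 0 y) < e / 3"
      using uniform_limit_\<phi>[of 0 x] e(2) by (intro uniform_limitD) auto
    then show "\<forall>\<^sub>F \<omega> in at 0 within {0..}. \<forall>y\<in>{0..x}. \<bar>profile.u2 p q \<omega> (\<phi> \<omega>) y - P.u2 y\<bar>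
        \<le> (1 + C) * \<bar>u \<omega> y - u 0 y\<bar> + e"
      using near dN_close[OF order_refl e(1), of x] small
    proof eventually_elim
      case (elim \<omega>)
      then have \<omega>: "0 \<le> \<omega>" "\<omega> \<le> 1"
        by auto
      show ?case
      proof
        fix y
        assume y: "y \<in> {0..x}"
        let ?w = "u \<omega> y - u 0 y"
        have "\<phi> \<omega> y \<le> B"
          using le_M[OF \<omega>(1), of y] M_mono[OF \<omega>] by (simp add: B_def)
        then have "\<bar>dN (\<phi> \<omega> y)\<bar> \<le> C"
          using pos[OF \<omega>(1), of y] by (intro C) auto
        then have coeff: "\<bar>\<omega> + dN (\<phi> \<omega> y)\<bar> \<le> 1 + C"
          using \<omega> by linarith
        have small: "\<bar>\<omega>\<bar> \<le> e / (3 * C')"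
          using \<omega>(1) elim(4) by linarith
        have close: "\<bar>\<phi> \<omega> y - \<phi> 0 y\<bar> \<le> e / 3"
          using elim(1) y by (auto simp: dist_real_def intro: less_imp_le)
        have "\<bar>dN (\<phi> \<omega> y) - dN (\<phi> 0 y)\<bar> \<le> e / (3 * C')"
          using elim(3) y by (auto intro: less_imp_le)
        \<comment> \<open>Three errors remain, from the frequency, the potential and the source;
          each is at most e/3.\<close>
        have "profile.u2 p q \<omega> (\<phi> \<omega>) y - P.u2 y = (\<omega> + dN (\<phi> \<omega> y)) * ?w
            + (\<omega> * u 0 y + ((dN (\<phi> \<omega> y) - dN (\<phi> 0 y)) * u 0 y + (\<phi> \<omega> y - \<phi> 0 y)))"
          using profile[OF \<omega>(1)]
          by (simp add: P.u2_def P.V_def profile.u2_def profile.V_def algebra_simps)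
        also have "\<bar>\<dots>\<bar> \<le> \<bar>(\<omega> + dN (\<phi> \<omega> y)) * ?w\<bar>
            + (\<bar>\<omega> * u 0 y\<bar> + (\<bar>(dN (\<phi> \<omega> y) - dN (\<phi> 0 y)) * u 0 y\<bar> + \<bar>\<phi> \<omega> y - \<phi> 0 y\<bar>))"
          by (intro abs_triangle_ineq[THEN order_trans] add_left_mono abs_triangle_ineq)
        also have "\<dots> \<le> (1 + C) * \<bar>?w\<bar> + (e / (3 * C') * C' + (e / (3 * C') * C' + e / 3))"
          unfolding abs_mult
          using small coeff close \<open>\<bar>dN (\<phi> \<omega> y) - dN (\<phi> 0 y)\<bar> \<le> e / (3 * C')\<close> C'[OF y] \<open>0 \<le> C\<close> e
          by (intro add_mono mult_mono) simp_all
        also have "e / (3 * C') * C' = e / 3"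
          using \<open>0 < C'\<close> by simp
        also have "(1 + C) * \<bar>?w\<bar> + (e / 3 + (e / 3 + e / 3)) = (1 + C) * \<bar>?w\<bar> + e"
          by simp
        finally show "\<bar>profile.u2 p q \<omega> (\<phi> \<omega>) y - P.u2 y\<bar> \<le> (1 + C) * \<bar>?w\<bar> + e" .
      qed
    qed
  qed
  then have "((\<lambda>\<omega>. u \<omega> x - u 0 x) \<longlongrightarrow> 0) (at 0 within {0..})"
    using assms by (intro tendsto_uniform_limitI) auto
  then show ?thesis
    by (rule LIM_zero_cancel)
qed

lemma tendsto_\<eta>: "((\<lambda>\<omega>. \<eta> \<phi> \<omega> x) \<longlongrightarrow> u 0 x) (at_right 0)"
proof -
  have "((\<lambda>\<omega>. u \<omega> \<bar>x\<bar>) \<longlongrightarrow> u 0 \<bar>x\<bar>) (at_right 0)"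
    using tendsto_u_nonneg[of "\<bar>x\<bar>"] by (rule tendsto_within_subset) auto
  moreover have "u \<omega> \<bar>x\<bar> = u \<omega> x" if "0 \<le> \<omega>" for \<omega>
    using profile.u_even[OF profile[OF that]] by (simp add: abs_if)
  ultimately have "((\<lambda>\<omega>. u \<omega> \<bar>x\<bar>) \<longlongrightarrow> u 0 x) (at_right 0)"
    by simp
  moreover have "\<forall>\<^sub>F \<omega> in at_right 0. u \<omega> \<bar>x\<bar> = \<eta> \<phi> \<omega> x"
    using eventually_at_right_less[of 0]
    by eventually_elim (simp add: \<eta>_eq_u \<open>\<And>\<omega>. 0 \<le> \<omega> \<Longrightarrow> u \<omega> \<bar>x\<bar> = u \<omega> x\<close>)
  ultimately show ?thesis
    by (rule Lim_transform_eventually)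
qed

end

theorem theorem1p2:
  fixes p q :: real and \<phi> :: "real \<Rightarrow> real \<Rightarrow> real"
  assumes "1 < p" and "p < q"
    and "\<And>\<omega>. \<omega> \<ge> 0 \<Longrightarrow> ground_state p q \<omega> (\<phi> \<omega>)"
  shows "\<exists>\<eta>0 :: real \<Rightarrow> real.
           smooth \<eta>0 \<and> (\<forall>x. \<eta>0 (- x) = \<eta>0 x) \<and>
           (\<forall>x. ((\<lambda>\<omega>. \<eta> \<phi> \<omega> x) \<longlongrightarrow> \<eta>0 x) (at_right 0)) \<and>
           (\<forall>x. - deriv (deriv \<eta>0) x + p * \<phi> 0 x powr (p - 1) * \<eta>0 x
                  - q * \<phi> 0 x powr (q - 1) * \<eta>0 x = - \<phi> 0 x) \<and>
           asymp_const \<eta>0 (\<lambda>x. - (x powr (- 2 / (p - 1) + 2))) \<and>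
           deriv \<eta>0 \<in> O[at_top](\<lambda>x. x powr (- 2 / (p - 1) + 1))"
proof -
  interpret ground_states p q \<phi>
    using assms by unfold_locales auto
  interpret P: zero_profile p q "\<phi> 0"
    by (simp add: zero_profile_def profile)
  have d1: "deriv P.u = P.u1"
    using DERIV_imp_deriv[OF P.D_u] by (rule ext)
  have "deriv P.u1 x = P.u2 x" for x
    by (rule DERIV_imp_deriv[OF P.D_u1])
  then have "\<forall>x. - deriv (deriv P.u) x + p * \<phi> 0 x powr (p - 1) * P.u x
      - q * \<phi> 0 x powr (q - 1) * P.u x = - \<phi> 0 x"
    by (simp add: d1 P.u2_def P.V_def dN_def algebra_simps)
  then show ?thesis
    using P.smooth_u P.u_even tendsto_\<eta> P.u_asymp P.u1_bigo
    by (intro exI[of _ P.u]) (auto simp: d1)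
qed

end
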